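(* Let $\widetilde{x}_0 \in \mathbb{R}^d$ with $P(\widetilde x_0)>P(x_* )$, $m \in \mathbb{N}$, $b \in [n]$, $S \in \mathbb{N}$ (with $m,S\geq 1$), and let $$\gamma=\gamma_*=\tfrac12\Big(3+\sqrt{9+\tfrac{8b}{m+1}}\Big),\qquad m_0 = \min\left\{\left\lceil \sqrt{\Big(1+\tfrac{\gamma (m+1)}{b}\Big)\bar L\,\frac{\|\widetilde{x}_0 - x_*\|^2}{P(\widetilde{x}_0) - P(x_* )}}\,\right\rceil, m\right\},\qquad U = \lceil \log_{\sqrt{\gamma}}(m/m_0)\rceil .$$ Let $\widetilde x_S$ denote the output of DASVRDA$^{\mathrm{ns}}$ with warm start$(\widetilde{x}_{0}, \gamma_*, \{ L_i \}_{i=1}^n, m_0, m, b, U, S)$. Then $$\mathbb{E} \left[P(\widetilde{x}_{S})-P(x_{*})\right] \leq O\left(\frac{1}{S^2}\left(\frac{1}{m^2} + \frac{1}{mb}\right)\bar L\| \widetilde{x}_0 - x_* \|^2\right),$$ where $O(\cdot)$ hides an absolute constant (independent of $n,d,m,b,S,\widetilde x_0$, the $L_i$, the $f_i$ and $R$).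
   Context: Setting. $n,d\ge 1$, $[n]=\{1,\dots,n\}$, $\|\cdot\|$ is the Euclidean norm on $\mathbb{R}^d$. Each $f_i:\mathbb{R}^d\to\mathbb{R}$ ($i\in[n]$) is convex, differentiable and $L_i$-smooth with $L_i>0$, i.e. $\|\nabla f_i(x)-\nabla f_i(y)\|\le L_i\|x-y\|$ for all $x,y$. $F=\frac1n\sum_{i=1}^n f_i$. $R:\mathbb{R}^d\to\mathbb{R}$ is convex (possibly non-differentiable) and relatively simple (its proximal mapping is computable at $O(d)$ cost). $P=F+R$, and $x_*$ is a minimizer of $P$, assumed to exist. $\bar L=\frac1n\sum_{i=1}^n L_i$, and $Q=\{q_i\}_{i=1}^n$ is the probability distribution on $[n]$ with $q_i=\frac{L_i}{n\bar L}$. $\mathrm{prox}_{f}(y)=\mathrm{argmin}_{x}\{\frac12\|x-y\|^2+f(x)\}$. Procedure One Stage AccSVRDA$(\widetilde y,\widetilde x,\eta,m,b,Q)$: set $x_0=z_0=\widetilde y$, $\bar g_0=0$, $\theta_0=\frac12$. For $k=1,\dots,m$: draw $i_k^1,\dots,i_k^b$ independently from $Q$ (independently of the past), let $I_k$ be this sample of $b$ indices (with multiplicity); $\theta_k=\frac{k+1}{2}$; $y_k=(1-\frac1{\theta_k})x_{k-1}+\frac1{\theta_k}z_{k-1}$; $g_k=\frac1b\sum_{i\in I_k}\frac{1}{nq_i}(\nabla f_i(y_k)-\nabla f_i(\widetilde x))+\nabla F(\widetilde x)$; $\bar g_k=(1-\frac1{\theta_k})\bar g_{k-1}+\frac1{\theta_k}g_k$;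 $z_k=\mathrm{argmin}_{z}\{\langle \bar g_k,z\rangle+R(z)+\frac{1}{2\eta\theta_k\theta_{k-1}}\|z-z_0\|^2\}=\mathrm{prox}_{\eta\theta_k\theta_{k-1}R}(z_0-\eta\theta_k\theta_{k-1}\bar g_k)$; $x_k=(1-\frac1{\theta_k})x_{k-1}+\frac1{\theta_k}z_k$. Output $(x_m,z_m)$. Procedure $\mathrm{DASVRDA}^{\mathrm{ns}}(\widetilde x_0,\widetilde z_0,\gamma,\{L_i\},m,b,S)$ ($\gamma>1$): set $\widetilde x_{-1}=\widetilde z_0$, $\widetilde\theta_0=1-\frac1\gamma$, $\eta=\frac{1}{(1+\gamma(m+1)/b)\bar L}$. For $s=1,\dots,S$: $\widetilde\theta_s=(1-\frac1\gamma)\frac{s+2}{2}$; $\widetilde y_s=\widetilde x_{s-1}+\frac{\widetilde\theta_{s-1}-1}{\widetilde\theta_s}(\widetilde x_{s-1}-\widetilde x_{s-2})+\frac{\widetilde\theta_{s-1}}{\widetilde\theta_s}(\widetilde z_{s-1}-\widetilde x_{s-1})$; $(\widetilde x_s,\widetilde z_s)=$ One Stage AccSVRDA$(\widetilde y_s,\widetilde x_{s-1},\eta,m,b,Q)$ with fresh independent samples. Output $\widetilde x_S$. Procedure DASVRDA$^{\mathrm{ns}}$ with warm start$(\widetilde x_0,\gamma,\{L_i\},m_0,m,b,U,S)$: set $\widetilde z_0=\widetilde x_0$; for $u=1,\dots,U$ set $m_u=\lceil\sqrt{\gamma(m_{u-1}+1)m_{u-1}}\rceil$; set $m_U'=\lceil\sqrt{(m_U+1)m_U}/(1-1/\gamma)\rceil$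 and $\eta=\frac{1}{(1+\gamma(m_U'+1)/b)\bar L}$; for $u=1,\dots,U$ set $(\widetilde x_u,\widetilde z_u)=$ One Stage AccSVRDA$(\widetilde z_{u-1},\widetilde x_{u-1},\eta,m_u,b,Q)$ with fresh independent samples; output the result of $\mathrm{DASVRDA}^{\mathrm{ns}}(\widetilde x_U,\widetilde z_U,\gamma,\{L_i\},m_U',b,S)$. Expectation is over all random index draws. *)

theory Defs
  imports "HOL-Analysis.Analysis" "HOL-Probability.Probability"
begin

section \<open>The Euclidean spaces of all finite dimensions inside one type\<close>

text \<open>
  The convergence bound has a constant that does not depend on the dimension \<open>d\<close>, so the dimension
  has to be quantified inside the formula and cannot be a type. All spaces of dimension \<open>d\<close> are
  therefore taken as subspaces \<open>Rd d\<close> of the inner product space of finitely supported real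
  sequences. On \<open>Rd d\<close> the inner product and norm are the usual Euclidean ones; a function on the
  \<open>d\<close>-dimensional space is a function on \<open>rvec\<close> of which only the restriction to \<open>Rd d\<close> matters.
\<close>

typedef rvec = "{x :: nat \<Rightarrow> real. finite {i. x i \<noteq> 0}}"
  morphisms coord Abs_rvec
  by (rule exI[of _ "\<lambda>_. 0"]) simp

setup_lifting type_definition_rvec

lemma rvec_eqI: "(\<And>i. coord x i = coord y i) \<Longrightarrow> x = y"
  by (simp add: coord_inject[symmetric] fun_eq_iff)

lemma finite_coord [simp]: "finite {i. coord x i \<noteq> 0}"
  using coord[of x] by simp

instantiation rvec :: real_vector
begin

lift_definition zero_rvec :: rvec is "\<lambda>_. 0"
  by simp

lift_definition plus_rvec :: "rvec \<Rightarrow> rvec \<Rightarrow> rvec" is "\<lambda>x y i. x i + y i"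
proof -
  fix x y :: "nat \<Rightarrow> real"
  assume "finite {i. x i \<noteq> 0}" "finite {i. y i \<noteq> 0}"
  then have "finite ({i. x i \<noteq> 0} \<union> {i. y i \<noteq> 0})" by simp
  then show "finite {i. x i + y i \<noteq> 0}" by (rule rev_finite_subset) auto
qed

lift_definition uminus_rvec :: "rvec \<Rightarrow> rvec" is "\<lambda>x i. - x i"
  by simp

lift_definition minus_rvec :: "rvec \<Rightarrow> rvec \<Rightarrow> rvec" is "\<lambda>x y i. x i - y i"
proof -
  fix x y :: "nat \<Rightarrow> real"
  assume "finite {i. x i \<noteq> 0}" "finite {i. y i \<noteq> 0}"
  then have "finite ({i. x i \<noteq> 0} \<union> {i. y i \<noteq> 0})" by simp
  then show "finite {i. x i - y i \<noteq> 0}" by (rule rev_finite_subset) auto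
qed

lift_definition scaleR_rvec :: "real \<Rightarrow> rvec \<Rightarrow> rvec" is "\<lambda>c x i. c * x i"
  by (erule rev_finite_subset) auto

instance
proof
  fix x y z :: rvec and a b :: real
  show "x + y + z = x + (y + z)" by transfer auto
  show "x + y = y + x" by transfer auto
  show "0 + x = x" by transfer auto
  show "- x + x = 0" by transfer auto
  show "x - y = x + - y" by transfer auto
  show "a *\<^sub>R (x + y) = a *\<^sub>R x + a *\<^sub>R y" by transfer (auto simp: algebra_simps)
  show "(a + b) *\<^sub>R x = a *\<^sub>R x + b *\<^sub>R x" by transfer (auto simp: algebra_simps)
  show "a *\<^sub>R b *\<^sub>R x = (a * b) *\<^sub>R x" by transfer auto
  show "1 *\<^sub>R x = x" by transfer auto
qed

end

instantiation rvec :: real_inner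
begin

definition inner_rvec :: "rvec \<Rightarrow> rvec \<Rightarrow> real" where
  "inner_rvec x y = (\<Sum>i | coord x i \<noteq> 0. coord x i * coord y i)"

definition norm_rvec :: "rvec \<Rightarrow> real" where
  "norm_rvec x = sqrt (x \<bullet> x)"

definition sgn_rvec :: "rvec \<Rightarrow> rvec" where
  "sgn_rvec x = x /\<^sub>R norm x"

definition dist_rvec :: "rvec \<Rightarrow> rvec \<Rightarrow> real" where
  "dist_rvec x y = norm (x - y)"

definition uniformity_rvec :: "(rvec \<times> rvec) filter" where
  "uniformity_rvec = (INF e\<in>{0<..}. principal {(x, y). dist x y < e})"

definition open_rvec :: "rvec set \<Rightarrow> bool" where
  "open_rvec U = (\<forall>x\<in>U. \<forall>\<^sub>F (x', y) in uniformity. x' = x \<longrightarrow> y \<in> U)"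

instance
proof
  fix x y z :: rvec and a :: real
  have inner_sum: "u \<bullet> v = (\<Sum>i\<in>A. coord u i * coord v i)"
    if "finite A" "{i. coord u i \<noteq> 0} \<subseteq> A" for u v :: rvec and A
    unfolding inner_rvec_def using that by (intro sum.mono_neutral_left) auto
  let ?A = "{i. coord x i \<noteq> 0} \<union> {i. coord y i \<noteq> 0}"
  have A: "finite ?A" by simp
  show "dist x y = norm (x - y)" by (rule dist_rvec_def)
  show "sgn x = x /\<^sub>R norm x" by (rule sgn_rvec_def)
  show "(uniformity :: (rvec \<times> rvec) filter) = (INF e\<in>{0<..}. principal {(x, y). dist x y < e})"
    by (rule uniformity_rvec_def)
  show "open U = (\<forall>x\<in>U. \<forall>\<^sub>F (x', y) in uniformity. x' = x \<longrightarrow> y \<in> U)" for U :: "rvec set"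
    by (rule open_rvec_def)
  show "x \<bullet> y = y \<bullet> x"
    using inner_sum[OF A, of x y] inner_sum[OF A, of y x] by (simp add: mult.commute)
  show "(x + y) \<bullet> z = x \<bullet> z + y \<bullet> z"
  proof -
    have "{i. coord (x + y) i \<noteq> 0} \<subseteq> ?A" by (auto simp: plus_rvec.rep_eq)
    then show ?thesis
      using inner_sum[OF A, of x z] inner_sum[OF A, of y z] inner_sum[OF A, of "x + y" z]
      by (auto simp: plus_rvec.rep_eq algebra_simps sum.distrib)
  qed
  show "a *\<^sub>R x \<bullet> y = a * (x \<bullet> y)"
  proof -
    have "{i. coord (a *\<^sub>R x) i \<noteq> 0} \<subseteq> ?A" by (auto simp: scaleR_rvec.rep_eq)
    then show ?thesis
      using inner_sum[OF A, of x y] inner_sum[OF A, of "a *\<^sub>R x" y]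
      by (auto simp: scaleR_rvec.rep_eq algebra_simps sum_distrib_left)
  qed
  show "0 \<le> x \<bullet> x" unfolding inner_rvec_def by (simp add: sum_nonneg)
  show "x \<bullet> x = 0 \<longleftrightarrow> x = 0"
  proof
    assume "x \<bullet> x = 0"
    then have "coord x i = 0" for i
      unfolding inner_rvec_def by (subst (asm) sum_nonneg_eq_0_iff) auto
    then show "x = 0" by (intro rvec_eqI) (simp add: zero_rvec.rep_eq)
  qed (simp add: inner_rvec_def zero_rvec.rep_eq)
  show "norm x = sqrt (x \<bullet> x)" by (rule norm_rvec_def)
qed

end

definition Rd :: "nat \<Rightarrow> rvec set" where
  "Rd d = {x. \<forall>i\<ge>d. coord x i = 0}"

lemma inner_Rd: "x \<in> Rd d \<Longrightarrow> x \<bullet> y = (\<Sum>i<d. coord x i * coord y i)"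
  unfolding inner_rvec_def Rd_def
  by (intro sum.mono_neutral_left) (auto simp: not_le[symmetric])

lemma norm_Rd: "x \<in> Rd d \<Longrightarrow> norm x = sqrt (\<Sum>i<d. (coord x i)\<^sup>2)"
  by (simp add: norm_eq_sqrt_inner inner_Rd power2_eq_square)

lemma ex1_coords_Rd: "\<exists>!x. x \<in> Rd d \<and> (\<forall>i<d. coord x i = a i)"
proof (rule ex1I)
  have "finite {i. (if i < d then a i else 0) \<noteq> 0}"
    by (rule finite_subset[of _ "{..<d}"]) (auto split: if_splits)
  then have c: "coord (Abs_rvec (\<lambda>i. if i < d then a i else 0)) = (\<lambda>i. if i < d then a i else 0)"
    by (intro Abs_rvec_inverse) simp
  show "Abs_rvec (\<lambda>i. if i < d then a i else 0) \<in> Rd d \<and>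
      (\<forall>i<d. coord (Abs_rvec (\<lambda>i. if i < d then a i else 0)) i = a i)"
    by (simp add: Rd_def c)
  fix x assume "x \<in> Rd d \<and> (\<forall>i<d. coord x i = a i)"
  then show "x = Abs_rvec (\<lambda>i. if i < d then a i else 0)"
    by (intro rvec_eqI) (auto simp: Rd_def c)
qed


section \<open>Finite sums of smooth functions\<close>

definition gradient :: "nat \<Rightarrow> (rvec \<Rightarrow> real) \<Rightarrow> rvec \<Rightarrow> rvec" where
  "gradient d f x = (THE g. g \<in> Rd d \<and> (f has_derivative (\<lambda>h. g \<bullet> h)) (at x within Rd d))"

definition smooth :: "nat \<Rightarrow> real \<Rightarrow> (rvec \<Rightarrow> real) \<Rightarrow> bool" where
  "smooth d L f \<longleftrightarrow> f differentiable_on Rd d \<and>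
     (\<forall>x\<in>Rd d. \<forall>y\<in>Rd d. norm (gradient d f x - gradient d f y) \<le> L * norm (x - y))"

definition avg :: "nat \<Rightarrow> (nat \<Rightarrow> real) \<Rightarrow> real" where
  "avg n a = (1 / real n) * (\<Sum>i=1..n. a i)"

definition avg_fun :: "nat \<Rightarrow> (nat \<Rightarrow> rvec \<Rightarrow> real) \<Rightarrow> rvec \<Rightarrow> real" where
  "avg_fun n f x = avg n (\<lambda>i. f i x)"

definition sampling_pmf :: "nat \<Rightarrow> (nat \<Rightarrow> real) \<Rightarrow> nat pmf" where
  "sampling_pmf n L = embed_pmf (\<lambda>i. if i \<in> {1..n} then L i / (real n * avg n L) else 0)"

lemma pmf_sampling_pmf:
  assumes n: "n \<ge> 1" and L: "\<And>i. i \<in> {1..n} \<Longrightarrow> L i > 0"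
  shows "pmf (sampling_pmf n L) i = (if i \<in> {1..n} then L i / (real n * avg n L) else 0)"
proof -
  let ?q = "\<lambda>i. if i \<in> {1..n} then L i / (real n * avg n L) else 0"
  have s: "real n * avg n L = (\<Sum>i=1..n. L i)" using n by (simp add: avg_def)
  have pos: "(\<Sum>i=1..n. L i) > 0" using n L by (intro sum_pos) auto
  have nonneg: "?q i \<ge> 0" for i using L[of i] pos by (auto simp: s intro!: divide_nonneg_pos less_imp_le)
  have "(\<integral>\<^sup>+i. ennreal (?q i) \<partial>count_space UNIV) = (\<Sum>i=1..n. ennreal (?q i))"
    by (intro nn_integral_count_space') (auto split: if_splits)
  also have "\<dots> = ennreal (\<Sum>i=1..n. ?q i)"
    by (rule sum_ennreal) (rule nonneg)
  also have "(\<Sum>i=1..n. ?q i) = 1"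
    using pos by (simp add: s sum_divide_distrib[symmetric])
  finally have "(\<integral>\<^sup>+i. ennreal (?q i) \<partial>count_space UNIV) = 1" by simp
  then show ?thesis
    unfolding sampling_pmf_def by (rule pmf_embed_pmf[OF nonneg])
qed


section \<open>One Stage AccSVRDA\<close>

definition theta :: "nat \<Rightarrow> real" where
  "theta k = (real k + 1) / 2"

text \<open>
  One inner iteration with index \<open>k \<ge> 1\<close>, taking the state after \<open>k - 1\<close> iterations to the state
  after \<open>k\<close> iterations. The mini-batch \<open>I\<close> is a list, so indices count with multiplicity. The
  components of the state are the iterates \<open>x\<close>, \<open>z\<close> and the averaged gradient; \<open>yt\<close> (which is also
  the initial \<open>z\<close>) and \<open>xt\<close> are the two vectors passed to the procedure. The minimum defining \<open>z'\<close>
  is attained exactly once for \<open>\<eta> > 0\<close> and convex \<open>R\<close>.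
\<close>

definition accsvrda_step ::
  "nat \<Rightarrow> nat \<Rightarrow> (nat \<Rightarrow> rvec \<Rightarrow> real) \<Rightarrow> (rvec \<Rightarrow> real) \<Rightarrow> rvec \<Rightarrow> rvec \<Rightarrow> real \<Rightarrow> nat \<Rightarrow> nat pmf \<Rightarrow>
   nat \<Rightarrow> nat list \<Rightarrow> rvec \<times> rvec \<times> rvec \<Rightarrow> rvec \<times> rvec \<times> rvec" where
  "accsvrda_step d n f R yt xt \<eta> b Q k I = (\<lambda>(x, z, gbar).
     let y = (1 - 1 / theta k) *\<^sub>R x + (1 / theta k) *\<^sub>R z;
         g = (1 / real b) *\<^sub>R
               (\<Sum>i\<leftarrow>I. (1 / (real n * pmf Q i)) *\<^sub>R (gradient d (f i) y - gradient d (f i) xt))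
             + gradient d (avg_fun n f) xt;
         gbar' = (1 - 1 / theta k) *\<^sub>R gbar + (1 / theta k) *\<^sub>R g;
         z' = arg_min_on (\<lambda>w. gbar' \<bullet> w + R w
                 + 1 / (2 * \<eta> * theta k * theta (k - 1)) * (norm (w - yt))\<^sup>2) (Rd d);
         x' = (1 - 1 / theta k) *\<^sub>R x + (1 / theta k) *\<^sub>R z'
     in (x', z', gbar'))"

primrec accsvrda_state ::
  "nat \<Rightarrow> nat \<Rightarrow> (nat \<Rightarrow> rvec \<Rightarrow> real) \<Rightarrow> (rvec \<Rightarrow> real) \<Rightarrow> rvec \<Rightarrow> rvec \<Rightarrow> real \<Rightarrow> nat \<Rightarrow> nat pmf \<Rightarrow>
   nat \<Rightarrow> (rvec \<times> rvec \<times> rvec) pmf" where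
  "accsvrda_state d n f R yt xt \<eta> b Q 0 = return_pmf (yt, yt, 0)"
| "accsvrda_state d n f R yt xt \<eta> b Q (Suc k) = do {
     st \<leftarrow> accsvrda_state d n f R yt xt \<eta> b Q k;
     I \<leftarrow> replicate_pmf b Q;
     return_pmf (accsvrda_step d n f R yt xt \<eta> b Q (Suc k) I st)
   }"

definition one_stage_accsvrda ::
  "nat \<Rightarrow> nat \<Rightarrow> (nat \<Rightarrow> rvec \<Rightarrow> real) \<Rightarrow> (rvec \<Rightarrow> real) \<Rightarrow> rvec \<Rightarrow> rvec \<Rightarrow> real \<Rightarrow> nat \<Rightarrow> nat \<Rightarrow>
   nat pmf \<Rightarrow> (rvec \<times> rvec) pmf" where
  "one_stage_accsvrda d n f R yt xt \<eta> m b Q =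
     map_pmf (\<lambda>(x, z, gbar). (x, z)) (accsvrda_state d n f R yt xt \<eta> b Q m)"


section \<open>DASVRDA for non-strongly convex objectives\<close>

definition step_size :: "nat \<Rightarrow> (nat \<Rightarrow> real) \<Rightarrow> real \<Rightarrow> nat \<Rightarrow> nat \<Rightarrow> real" where
  "step_size n L \<gamma> m b = 1 / ((1 + \<gamma> * (real m + 1) / real b) * avg n L)"

definition theta_outer :: "real \<Rightarrow> nat \<Rightarrow> real" where
  "theta_outer \<gamma> s = (1 - 1 / \<gamma>) * ((real s + 2) / 2)"

text \<open>
  The state after \<open>s\<close> stages consists of the current output \<open>x\<close>, the output of the stage before it
  (initially the starting vector for \<open>z\<close>), and the current \<open>z\<close>.
\<close>

primrec dasvrda_ns_state ::
  "nat \<Rightarrow> nat \<Rightarrow> (nat \<Rightarrow> rvec \<Rightarrow> real) \<Rightarrow> (rvec \<Rightarrow> real) \<Rightarrow> rvec \<Rightarrow> rvec \<Rightarrow> real \<Rightarrow> (nat \<Rightarrow> real) \<Rightarrow>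
   nat \<Rightarrow> nat \<Rightarrow> nat \<Rightarrow> (rvec \<times> rvec \<times> rvec) pmf" where
  "dasvrda_ns_state d n f R x0 z0 \<gamma> L m b 0 = return_pmf (x0, z0, z0)"
| "dasvrda_ns_state d n f R x0 z0 \<gamma> L m b (Suc s) = do {
     (x, xprev, z) \<leftarrow> dasvrda_ns_state d n f R x0 z0 \<gamma> L m b s;
     let y = x + ((theta_outer \<gamma> s - 1) / theta_outer \<gamma> (Suc s)) *\<^sub>R (x - xprev)
               + (theta_outer \<gamma> s / theta_outer \<gamma> (Suc s)) *\<^sub>R (z - x);
     (x', z') \<leftarrow>
       one_stage_accsvrda d n f R y x (step_size n L \<gamma> m b) m b (sampling_pmf n L);
     return_pmf (x', x, z')
   }"

definition dasvrda_ns ::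
  "nat \<Rightarrow> nat \<Rightarrow> (nat \<Rightarrow> rvec \<Rightarrow> real) \<Rightarrow> (rvec \<Rightarrow> real) \<Rightarrow> rvec \<Rightarrow> rvec \<Rightarrow> real \<Rightarrow> (nat \<Rightarrow> real) \<Rightarrow>
   nat \<Rightarrow> nat \<Rightarrow> nat \<Rightarrow> rvec pmf" where
  "dasvrda_ns d n f R x0 z0 \<gamma> L m b S =
     map_pmf (\<lambda>(x, xprev, z). x) (dasvrda_ns_state d n f R x0 z0 \<gamma> L m b S)"


section \<open>Warm start\<close>

primrec warm_m :: "real \<Rightarrow> nat \<Rightarrow> nat \<Rightarrow> nat" where
  "warm_m \<gamma> m0 0 = m0"
| "warm_m \<gamma> m0 (Suc u) = nat \<lceil>sqrt (\<gamma> * (real (warm_m \<gamma> m0 u) + 1) * real (warm_m \<gamma> m0 u))\<rceil>"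

definition warm_m_final :: "real \<Rightarrow> nat \<Rightarrow> nat \<Rightarrow> nat" where
  "warm_m_final \<gamma> m0 U =
     nat \<lceil>sqrt ((real (warm_m \<gamma> m0 U) + 1) * real (warm_m \<gamma> m0 U)) / (1 - 1 / \<gamma>)\<rceil>"

primrec warm_state ::
  "nat \<Rightarrow> nat \<Rightarrow> (nat \<Rightarrow> rvec \<Rightarrow> real) \<Rightarrow> (rvec \<Rightarrow> real) \<Rightarrow> rvec \<Rightarrow> real \<Rightarrow> (nat \<Rightarrow> real) \<Rightarrow>
   nat \<Rightarrow> real \<Rightarrow> nat \<Rightarrow> nat \<Rightarrow> (rvec \<times> rvec) pmf" where
  "warm_state d n f R x0 \<gamma> L m0 \<eta> b 0 = return_pmf (x0, x0)"
| "warm_state d n f R x0 \<gamma> L m0 \<eta> b (Suc u) = do {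
     (x, z) \<leftarrow> warm_state d n f R x0 \<gamma> L m0 \<eta> b u;
     one_stage_accsvrda d n f R z x \<eta> (warm_m \<gamma> m0 (Suc u)) b (sampling_pmf n L)
   }"

text \<open>
  The procedure is called with the inner loop length \<open>m\<close>, but its body does not refer to \<open>m\<close>:
  that value matters only through the choice of \<open>\<gamma>\<close>, \<open>m0\<close> and \<open>U\<close>.
\<close>

definition dasvrda_ns_warm ::
  "nat \<Rightarrow> nat \<Rightarrow> (nat \<Rightarrow> rvec \<Rightarrow> real) \<Rightarrow> (rvec \<Rightarrow> real) \<Rightarrow> rvec \<Rightarrow> real \<Rightarrow> (nat \<Rightarrow> real) \<Rightarrow>
   nat \<Rightarrow> nat \<Rightarrow> nat \<Rightarrow> nat \<Rightarrow> nat \<Rightarrow> rvec pmf" where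
  "dasvrda_ns_warm d n f R x0 \<gamma> L m0 m b U S = do {
     let m' = warm_m_final \<gamma> m0 U;
     (x, z) \<leftarrow> warm_state d n f R x0 \<gamma> L m0 (step_size n L \<gamma> m' b) b U;
     dasvrda_ns d n f R x z \<gamma> L m' b S
   }"

end

theory Submission
  imports Defs
begin

text \<open>
  Three effects are combined: acceleration inside a stage, variance reduction by the snapshot, and
  acceleration over the stages.

  \<^emph>\<open>One stage.\<close> For a fixed comparison point \<open>x\<close>, the weighted objective minus the minimum of the
  dual averaging model, plus the model value at \<open>x\<close>, is a function of the current state. One
  iteration raises its expectation by at most the weight of that iteration times the value at \<open>x\<close> of
  the linearised objective plus \<open>gap xt y / (4 \<gamma>)\<close>, where \<open>gap\<close> is, up to a factor, the second moment of
  the sampled gradient differences to the snapshot \<open>xt\<close>. The step size is small enough to turn the variance into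
  this term. Any uniform bound \<open>B\<close> on the sum then bounds the stage: the expected objective plus a
  multiple \<open>K\<close> of the squared distance from \<open>x\<close> to the last \<open>z\<close> is at most \<open>B\<close> plus \<open>K\<close> times the
  squared distance from \<open>x\<close> to the starting point (\<open>stage_bound\<close>). The bound \<open>B\<close> is found in two ways,
  both using that \<open>gap\<close> is at most twice a Bregman distance. If \<open>x\<close> lies on the segment from the
  snapshot to the minimiser and not too close to the latter, then the linearisation gap at the
  snapshot pays for the variance (\<open>stage_toward\<close>). Close to the minimiser \<open>xs\<close>, splitting through the
  gradients at \<open>xs\<close> leaves the Bregman distance from \<open>xs\<close> to the snapshot, divided by \<open>\<gamma>\<close>
  (\<open>stage_near\<close>).

  \<^emph>\<open>Outer loop.\<close> In stage \<open>s\<close> the comparison point has weight \<open>1 / \<theta> s\<close> on the minimiser. The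
  extrapolation is made such that the scaled distance terms of successive stages telescope, so an
  energy with weight \<open>(\<theta> s)\<^sup>2\<close> on the excess never grows after the first stage (\<open>energy_step\<close>). This is
  the factor \<open>1 / S\<^sup>2\<close>.

  \<^emph>\<open>Warm start.\<close> Each of its stages is compared with the minimiser itself. It multiplies the excess by
  \<open>1 / \<gamma>\<close>, and the stage lengths grow such that the weight of the distance term shrinks by the same
  factor (\<open>warm_decay\<close>). After \<open>U\<close> stages the factor \<open>(1 / \<gamma>)\<^sup>U\<close> is at most \<open>(m0 / m)\<^sup>2\<close>, and \<open>m0\<close> is chosen
  such that \<open>m0\<^sup>2\<close> times the initial potential is of order \<open>(1 + m / b) Lbar |x0 - xs|\<^sup>2\<close>. The special
  value of \<open>\<gamma>\<close> keeps the inverse step size for the final stage length of order \<open>(1 + m / b) Lbar\<close>.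

  One point needs care. If \<open>m0\<close> is raised to one by rounding, then the initial excess can be
  arbitrarily large compared with \<open>Lbar |x0 - xs|\<^sup>2\<close>, because the regulariser is not smooth. The
  potential therefore starts from the Bregman distance of the smooth part, which is bounded both by
  the excess and by \<open>Lbar |x0 - xs|\<^sup>2 / 2\<close>. A first stage compared with the minimiser sees only this
  distance; this also treats the case without warm-start stages (\<open>first_energy_equal_start\<close>).
\<close>

section \<open>Smooth convex functions on a linear subspace\<close>

lemma line_in_subspace:
  assumes "subspace V" "x \<in> V" "y \<in> V"
  shows "x + t *\<^sub>R (y - x) \<in> V"
  using assms by (simp add: subspace_add subspace_diff subspace_scale)

lemma has_derivative_along_line:
  fixes f :: "'a::real_inner \<Rightarrow> real"
  assumes f: "(f has_derivative (\<lambda>h. g \<bullet> h)) (at (x + t *\<^sub>R v) within V)"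
    and V: "\<And>s. x + s *\<^sub>R v \<in> V"
  shows "((\<lambda>s. f (x + s *\<^sub>R v)) has_real_derivative g \<bullet> v) (at t)"
proof -
  have l: "((\<lambda>s. x + s *\<^sub>R v) has_derivative (\<lambda>s. s *\<^sub>R v)) (at t)"
    by (auto intro!: derivative_eq_intros)
  have "(f has_derivative (\<lambda>h. g \<bullet> h)) (at (x + t *\<^sub>R v) within range (\<lambda>s. x + s *\<^sub>R v))"
    using V by (intro has_derivative_subset[OF f]) auto
  from has_derivative_in_compose[OF l this] show ?thesis
    by (simp add: has_field_derivative_def mult_commute_abs)
qed

lemma convex_on_along_line:
  fixes f :: "'a::real_vector \<Rightarrow> real"
  assumes f: "convex_on V f" and V: "\<And>s. x + s *\<^sub>R v \<in> V"
  shows "convex_on UNIV (\<lambda>s. f (x + s *\<^sub>R v))"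
proof (rule convex_onI)
  fix t r s :: real
  assume t: "0 < t" "t < 1"
  have "f ((1 - t) *\<^sub>R (x + r *\<^sub>R v) + t *\<^sub>R (x + s *\<^sub>R v)) \<le>
      (1 - t) * f (x + r *\<^sub>R v) + t * f (x + s *\<^sub>R v)"
    using t V by (intro convex_onD[OF f]) auto
  also have "(1 - t) *\<^sub>R (x + r *\<^sub>R v) + t *\<^sub>R (x + s *\<^sub>R v) = x + ((1 - t) *\<^sub>R r + t *\<^sub>R s) *\<^sub>R v"
    by (simp add: algebra_simps)
  finally show "f (x + ((1 - t) *\<^sub>R r + t *\<^sub>R s) *\<^sub>R v) \<le> (1 - t) * f (x + r *\<^sub>R v) + t * f (x + s *\<^sub>R v)" .
qed simp

lemma convex_on_above_gradient:
  fixes f :: "'a::real_inner \<Rightarrow> real"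
  assumes V: "subspace V" "x \<in> V" "y \<in> V" and f: "convex_on V f"
    and g: "(f has_derivative (\<lambda>h. g \<bullet> h)) (at x within V)"
  shows "f x + g \<bullet> (y - x) \<le> f y"
proof -
  have "((\<lambda>s. f (x + s *\<^sub>R (y - x))) has_real_derivative g \<bullet> (y - x)) (at 0)"
    using g by (intro has_derivative_along_line[of f g x 0 "y - x" V])
      (auto simp: line_in_subspace[OF V])
  from convex_on_imp_above_tangent[OF convex_on_along_line[OF f line_in_subspace[OF V]] _ _ _ this, of 1]
  show ?thesis by simp
qed

text \<open>Along the segment, the function minus the quadratic has a nonpositive derivative.\<close>

lemma smooth_below_quadratic:
  fixes f :: "'a::real_inner \<Rightarrow> real"
  assumes V: "subspace V" "x \<in> V" "y \<in> V"
    and g: "\<And>z. z \<in> V \<Longrightarrow> (f has_derivative (\<lambda>h. g z \<bullet> h)) (at z within V)"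
    and L: "\<And>z w. z \<in> V \<Longrightarrow> w \<in> V \<Longrightarrow> norm (g z - g w) \<le> L * norm (z - w)"
  shows "f y \<le> f x + g x \<bullet> (y - x) + L / 2 * (norm (y - x))\<^sup>2"
proof -
  define v where "v = y - x"
  have inV: "x + s *\<^sub>R v \<in> V" for s
    unfolding v_def by (rule line_in_subspace[OF V])
  define \<phi> where "\<phi> s = f (x + s *\<^sub>R v) - s * (g x \<bullet> v) - L / 2 * s\<^sup>2 * (norm v)\<^sup>2" for s
  have "\<phi> 1 \<le> \<phi> 0"
  proof (rule DERIV_nonpos_imp_nonincreasing[where f = \<phi>])
    fix t :: real assume t: "0 \<le> t" "t \<le> 1"
    have "((\<lambda>s. f (x + s *\<^sub>R v)) has_real_derivative g (x + t *\<^sub>R v) \<bullet> v) (at t)"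
      by (rule has_derivative_along_line[OF g[OF inV] inV])
    then have d: "(\<phi> has_real_derivative g (x + t *\<^sub>R v) \<bullet> v - g x \<bullet> v - L * t * (norm v)\<^sup>2) (at t)"
      unfolding \<phi>_def by (auto intro!: derivative_eq_intros)
    have "(g (x + t *\<^sub>R v) - g x) \<bullet> v \<le> norm (g (x + t *\<^sub>R v) - g x) * norm v"
      by (rule norm_cauchy_schwarz)
    also have "\<dots> \<le> L * norm (x + t *\<^sub>R v - x) * norm v"
      by (rule mult_right_mono[OF L[OF inV V(2)] norm_ge_zero])
    also have "\<dots> = L * t * (norm v)\<^sup>2"
      using t by (simp add: power2_eq_square)
    finally show "\<exists>y. (\<phi> has_real_derivative y) (at t) \<and> y \<le> 0"
      using d by (intro exI[of _ "g (x + t *\<^sub>R v) \<bullet> v - g x \<bullet> v - L * t * (norm v)\<^sup>2"])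
        (simp add: inner_diff_left)
  qed simp
  then show ?thesis by (simp add: \<phi>_def v_def)
qed

text \<open>
  Convexity keeps the function above its tangent at \<open>x\<close> and smoothness keeps it below a parabola
  touching it at \<open>y\<close>. Comparing the two at the minimum of the parabola minus the tangent, which is
  one gradient step away from \<open>y\<close>, leaves the squared gradient difference as a gap.
\<close>

lemma gradient_difference_le_Bregman:
  fixes f :: "'a::real_inner \<Rightarrow> real"
  assumes V: "subspace V" "x \<in> V" "y \<in> V" and f: "convex_on V f" and "L > 0"
    and g: "\<And>z. z \<in> V \<Longrightarrow> (f has_derivative (\<lambda>h. g z \<bullet> h)) (at z within V)" "\<And>z. z \<in> V \<Longrightarrow> g z \<in> V"
    and L: "\<And>z w. z \<in> V \<Longrightarrow> w \<in> V \<Longrightarrow> norm (g z - g w) \<le> L * norm (z - w)"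
  shows "(norm (g x - g y))\<^sup>2 / (2 * L) \<le> f x - f y - g y \<bullet> (x - y)"
proof -
  define w where "w = x - (1 / L) *\<^sub>R (g x - g y)"
  have w: "w \<in> V"
    unfolding w_def using V g by (simp add: subspace_diff subspace_scale)
  have "f y + g y \<bullet> (w - y) \<le> f w"
    by (rule convex_on_above_gradient[OF V(1) V(3) w f g(1)[OF V(3)]])
  also have "f w \<le> f x + g x \<bullet> (w - x) + L / 2 * (norm (w - x))\<^sup>2"
    by (rule smooth_below_quadratic[OF V(1,2) w g(1) L])
  finally have "f y + g y \<bullet> (w - y) - g x \<bullet> (w - x) - L / 2 * (norm (w - x))\<^sup>2 \<le> f x" by simp
  moreover define K where "K = (norm (g x - g y))\<^sup>2 / (2 * L)"
  moreover have "norm (w - x) = norm (g x - g y) / L"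
    unfolding w_def using \<open>L > 0\<close> by simp
  then have "L / 2 * (norm (w - x))\<^sup>2 = K"
    using \<open>L > 0\<close> by (simp add: K_def power2_eq_square)
  moreover have "(g x - g y) \<bullet> (w - x) = - 2 * K"
    using \<open>L > 0\<close> by (simp add: w_def K_def power2_norm_eq_inner)
  moreover have "g y \<bullet> (w - y) - g x \<bullet> (w - x) = g y \<bullet> (x - y) - (g x - g y) \<bullet> (w - x)"
    by (simp add: inner_diff_left inner_diff_right)
  ultimately show ?thesis by linarith
qed

text \<open>
  First-order optimality for a sum of a differentiable and a convex function: the negative gradient
  of the first is a subgradient of the second.
\<close>

lemma composite_minimizer_subgradient:
  fixes f R :: "'a::real_inner \<Rightarrow> real"
  assumes V: "subspace V" "z \<in> V" "x \<in> V" and R: "convex_on V R"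
    and g: "(f has_derivative (\<lambda>h. g \<bullet> h)) (at z within V)"
    and min: "\<And>w. w \<in> V \<Longrightarrow> f z + R z \<le> f w + R w"
  shows "R z - g \<bullet> (x - z) \<le> R x"
proof (rule ccontr)
  assume neg: "\<not> ?thesis"
  define \<phi> where "\<phi> s = f (z + s *\<^sub>R (x - z)) + s * (R x - R z)" for s
  have "((\<lambda>s. f (z + s *\<^sub>R (x - z))) has_real_derivative g \<bullet> (x - z)) (at 0)"
    using g by (intro has_derivative_along_line[of f g z 0 "x - z" V])
      (auto simp: line_in_subspace[OF V])
  then have "(\<phi> has_real_derivative g \<bullet> (x - z) + (R x - R z)) (at 0)"
    unfolding \<phi>_def by (auto intro!: derivative_eq_intros)
  from has_real_derivative_neg_dec_right[OF this] neg
  obtain e where e: "e > 0" "\<And>h. 0 < h \<Longrightarrow> h < e \<Longrightarrow> \<phi> h < \<phi> 0" by auto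
  define h where "h = min (e / 2) 1"
  have h: "0 < h" "h < e" "h \<le> 1" using e by (auto simp: h_def)
  have "R ((1 - h) *\<^sub>R z + h *\<^sub>R x) \<le> (1 - h) * R z + h * R x"
    using h V by (intro convex_onD[OF R]) auto
  also have "(1 - h) *\<^sub>R z + h *\<^sub>R x = z + h *\<^sub>R (x - z)" by (simp add: algebra_simps)
  finally have "f z \<le> \<phi> h"
    using min[OF line_in_subspace[OF V, of h]] by (simp add: \<phi>_def algebra_simps)
  with e(2)[OF h(1,2)] show False by (simp add: \<phi>_def)
qed

lemma norm_sq_diff_expand:
  fixes x y z :: "'a::real_inner"
  shows "(norm (x - y))\<^sup>2 = (norm (z - y))\<^sup>2 + 2 * ((z - y) \<bullet> (x - z)) + (norm (x - z))\<^sup>2"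
  by (simp add: power2_norm_eq_inner inner_diff_left inner_diff_right inner_commute)

text \<open>
  Strong convexity at the minimum, read off from the optimality condition with the quadratic as the
  differentiable part.
\<close>

lemma proximal_minimizer_growth:
  fixes q :: "'a::real_inner \<Rightarrow> real"
  assumes V: "subspace V" "z \<in> V" "x \<in> V" and q: "convex_on V q"
    and min: "\<And>w. w \<in> V \<Longrightarrow> q z + c * (norm (z - y))\<^sup>2 \<le> q w + c * (norm (w - y))\<^sup>2"
  shows "q z + c * (norm (z - y))\<^sup>2 + c * (norm (x - z))\<^sup>2 \<le> q x + c * (norm (x - y))\<^sup>2"
proof -
  have "((\<lambda>w. c * (norm (w - y))\<^sup>2) has_derivative (\<lambda>h. ((2 * c) *\<^sub>R (z - y)) \<bullet> h)) (at z within V)"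
    unfolding power2_norm_eq_inner
    by (auto intro!: derivative_eq_intros simp: inner_commute algebra_simps)
  from composite_minimizer_subgradient[OF V q this] min
  have "q z - 2 * c * ((z - y) \<bullet> (x - z)) \<le> q x" by (simp add: add.commute)
  moreover have "c * (norm (x - y))\<^sup>2 =
      c * (norm (z - y))\<^sup>2 + 2 * c * ((z - y) \<bullet> (x - z)) + c * (norm (x - z))\<^sup>2"
    unfolding norm_sq_diff_expand[of x y z] by (simp only: distrib_left mult.assoc mult.left_commute)
  ultimately show ?thesis by linarith
qed


section \<open>Gradients and proximal points on \<open>Rd\<close>\<close>

lemma subspace_Rd: "subspace (Rd d)"
  by (auto simp: subspace_def Rd_def zero_rvec.rep_eq plus_rvec.rep_eq scaleR_rvec.rep_eq)

lemma convex_Rd: "convex (Rd d)"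
  by (rule subspace_imp_convex[OF subspace_Rd])

lemmas Rd_closed [simp] =
  subspace_add[OF subspace_Rd] subspace_diff[OF subspace_Rd] subspace_scale[OF subspace_Rd]
  subspace_0[OF subspace_Rd]

lemma Rd_0: "Rd 0 = {0}"
  by (auto simp: Rd_def zero_rvec.rep_eq intro: rvec_eqI)

lemma Rd_Suc_split:
  obtains e where "e \<in> Rd (Suc d)" "e \<bullet> e = 1" "\<And>w. w \<in> Rd d \<Longrightarrow> w \<in> Rd (Suc d)"
    "\<And>w. w \<in> Rd d \<Longrightarrow> w \<bullet> e = 0 \<and> e \<bullet> w = 0"
    "\<And>w. w \<in> Rd (Suc d) \<Longrightarrow> \<exists>v\<in>Rd d. \<exists>t. w = v + t *\<^sub>R e"
proof -
  obtain e where e: "e \<in> Rd (Suc d)" "\<forall>i<Suc d. coord e i = (if i = d then 1 else 0)"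
    using ex1_coords_Rd[of "Suc d" "\<lambda>i. if i = d then 1 else 0"] by blast
  show thesis
  proof (rule that[of e])
    show "e \<in> Rd (Suc d)" by fact
    show "e \<bullet> e = 1" using e by (simp add: inner_Rd)
    show "w \<in> Rd (Suc d)" if "w \<in> Rd d" for w using that by (auto simp: Rd_def)
    show "w \<bullet> e = 0 \<and> e \<bullet> w = 0" if "w \<in> Rd d" for w
      using that e by (simp add: inner_Rd inner_commute[of e w])
    show "\<exists>v\<in>Rd d. \<exists>t. w = v + t *\<^sub>R e" if w: "w \<in> Rd (Suc d)" for w
    proof (intro bexI exI)
      show "w = (w - coord w d *\<^sub>R e) + coord w d *\<^sub>R e" by simp
      have "coord (w - coord w d *\<^sub>R e) i = 0" if "i \<ge> d" for i
        using that w e by (cases "i = d") (auto simp: Rd_def minus_rvec.rep_eq scaleR_rvec.rep_eq)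
      then show "w - coord w d *\<^sub>R e \<in> Rd d" by (auto simp: Rd_def)
    qed
  qed
qed

lemma Riesz_Rd:
  assumes "linear \<phi>"
  shows "\<exists>g\<in>Rd d. \<forall>h\<in>Rd d. \<phi> h = g \<bullet> h"
proof (induction d)
  case 0
  then show ?case using linear_0[OF assms] by (auto simp: Rd_0)
next
  case (Suc d)
  then obtain g where g: "g \<in> Rd d" "\<And>h. h \<in> Rd d \<Longrightarrow> \<phi> h = g \<bullet> h" by blast
  obtain e where e: "e \<in> Rd (Suc d)" "e \<bullet> e = 1" "\<And>w. w \<in> Rd d \<Longrightarrow> w \<in> Rd (Suc d)"
    "\<And>w. w \<in> Rd d \<Longrightarrow> w \<bullet> e = 0 \<and> e \<bullet> w = 0"
    "\<And>w. w \<in> Rd (Suc d) \<Longrightarrow> \<exists>v\<in>Rd d. \<exists>t. w = v + t *\<^sub>R e"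
    using Rd_Suc_split[of d] by metis
  show ?case
  proof (intro bexI ballI)
    show "g + \<phi> e *\<^sub>R e \<in> Rd (Suc d)" using e g by simp
    fix h assume "h \<in> Rd (Suc d)"
    then obtain v t where v: "v \<in> Rd d" "h = v + t *\<^sub>R e" using e(5) by blast
    then show "\<phi> h = (g + \<phi> e *\<^sub>R e) \<bullet> h"
      using g e(2) e(4)[OF v(1)] e(4)[OF g(1)]
      by (simp add: linear_add[OF assms] linear_scale[OF assms] inner_add)
  qed
qed

lemma gradient_eqI:
  assumes x: "x \<in> Rd d" and g: "g \<in> Rd d" "(f has_derivative (\<lambda>h. g \<bullet> h)) (at x within Rd d)"
  shows "gradient d f x = g"
  unfolding gradient_def
proof (rule the_equality)
  show "g \<in> Rd d \<and> (f has_derivative (\<lambda>h. g \<bullet> h)) (at x within Rd d)" using g by simp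
  fix g' assume g': "g' \<in> Rd d \<and> (f has_derivative (\<lambda>h. g' \<bullet> h)) (at x within Rd d)"
  have "((\<lambda>s. f (x + s *\<^sub>R (g' - g))) has_real_derivative k \<bullet> (g' - g)) (at 0)"
    if "(f has_derivative (\<lambda>h. k \<bullet> h)) (at x within Rd d)" for k
    using that x g g' by (intro has_derivative_along_line[of f k x 0 "g' - g" "Rd d"]) auto
  from DERIV_unique[OF this this, OF g(2) conjunct2[OF g']]
  have "(g' - g) \<bullet> (g' - g) = 0" by (simp add: inner_diff_left)
  then show "g' = g" by simp
qed

lemma gradient_exists:
  assumes f: "f differentiable_on Rd d" and x: "x \<in> Rd d"
  shows "gradient d f x \<in> Rd d \<and> (f has_derivative (\<lambda>h. gradient d f x \<bullet> h)) (at x within Rd d)"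
proof -
  obtain \<phi> where \<phi>: "(f has_derivative \<phi>) (at x within Rd d)"
    using f x by (auto simp: differentiable_on_def differentiable_def)
  obtain g where g: "g \<in> Rd d" "\<And>h. h \<in> Rd d \<Longrightarrow> \<phi> h = g \<bullet> h"
    using Riesz_Rd[OF has_derivative_linear[OF \<phi>]] by blast
  have "(f has_derivative (\<lambda>h. g \<bullet> h)) (at x within Rd d)"
    using \<phi> g x unfolding has_derivative_within_alt
    by (auto simp: bounded_linear_inner_right)
  then show ?thesis using gradient_eqI[OF x g(1)] g(1) by simp
qed

text \<open>A subgradient at zero shows that the quadratic term wins outside a compact interval.\<close>

lemma convex_plus_square_attains_min:
  fixes q :: "real \<Rightarrow> real"
  assumes q: "convex_on UNIV q" and "c > 0"
  shows "\<exists>t. \<forall>s. q t + c * t\<^sup>2 \<le> q s + c * s\<^sup>2"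
proof -
  obtain a where a: "\<And>s. q s \<ge> q 0 + a * s"
    using convex_le_Inf_differential[OF q, of 0] by auto
  define M where "M = \<bar>a\<bar> / c"
  have M: "M \<ge> 0" using \<open>c > 0\<close> by (simp add: M_def)
  have "continuous_on {-M..M} (\<lambda>s. q s + c * s\<^sup>2)"
    using convex_on_continuous[OF open_UNIV q]
    by (intro continuous_intros) (auto intro: continuous_on_subset)
  then obtain t where t: "t \<in> {-M..M}" "\<And>s. s \<in> {-M..M} \<Longrightarrow> q t + c * t\<^sup>2 \<le> q s + c * s\<^sup>2"
    using continuous_attains_inf[of "{-M..M}" "\<lambda>s. q s + c * s\<^sup>2"] M by auto
  have "q t + c * t\<^sup>2 \<le> q s + c * s\<^sup>2" if s: "s \<notin> {-M..M}" for s
  proof -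
    have "M \<le> \<bar>s\<bar>" using s by (cases "s \<ge> 0") auto
    then have "\<bar>a\<bar> \<le> c * \<bar>s\<bar>"
      using \<open>c > 0\<close> by (simp add: M_def pos_divide_le_eq mult.commute)
    then have "\<bar>a\<bar> * \<bar>s\<bar> \<le> c * \<bar>s\<bar> * \<bar>s\<bar>" by (rule mult_right_mono) simp
    then have "- (c * s\<^sup>2) \<le> a * s"
      using abs_ge_minus_self[of "a * s"] by (simp add: power2_eq_square abs_mult mult.assoc)
    then show ?thesis using a[of s] t(2)[of 0] M by simp
  qed
  then show ?thesis using t(2) by blast
qed

text \<open>
  The minimum is found one coordinate at a time: minimising over the first \<open>d\<close> coordinates leaves a
  convex function of the last one, so that only continuity on the real line enters.
\<close>

lemma convex_plus_norm_attains_min: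
  assumes "convex_on (Rd d) q" and c: "c > 0"
  shows "\<exists>z\<in>Rd d. \<forall>w\<in>Rd d. q z + c * (norm z)\<^sup>2 \<le> q w + c * (norm w)\<^sup>2"
  using assms(1)
proof (induction d arbitrary: q)
  case 0
  then show ?case by (simp add: Rd_0)
next
  case (Suc d)
  note q = Suc.prems
  obtain e where e: "e \<in> Rd (Suc d)" "e \<bullet> e = 1" "\<And>w. w \<in> Rd d \<Longrightarrow> w \<in> Rd (Suc d)"
    "\<And>w. w \<in> Rd d \<Longrightarrow> w \<bullet> e = 0 \<and> e \<bullet> w = 0"
    "\<And>w. w \<in> Rd (Suc d) \<Longrightarrow> \<exists>v\<in>Rd d. \<exists>t. w = v + t *\<^sub>R e"
    using Rd_Suc_split[of d] by metis
  have norm_split: "(norm (w + t *\<^sub>R e))\<^sup>2 = (norm w)\<^sup>2 + t\<^sup>2" if "w \<in> Rd d" for w t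
    using e(2) e(4)[OF that]
    unfolding power2_norm_eq_inner by (simp add: inner_add power2_eq_square)
  have "\<exists>z. z \<in> Rd d \<and> (\<forall>w\<in>Rd d. q (z + t *\<^sub>R e) + c * (norm z)\<^sup>2 \<le> q (w + t *\<^sub>R e) + c * (norm w)\<^sup>2)" for t
  proof -
    have "convex_on (Rd d) (\<lambda>w. q (w + t *\<^sub>R e))"
    proof (rule convex_onI)
      fix r x y assume *: "0 < r" "r < (1::real)" "x \<in> Rd d" "y \<in> Rd d"
      have "q ((1 - r) *\<^sub>R (x + t *\<^sub>R e) + r *\<^sub>R (y + t *\<^sub>R e)) \<le> (1 - r) * q (x + t *\<^sub>R e) + r * q (y + t *\<^sub>R e)"
        using * e by (intro convex_onD[OF q]) auto
      also have "(1 - r) *\<^sub>R (x + t *\<^sub>R e) + r *\<^sub>R (y + t *\<^sub>R e) = (1 - r) *\<^sub>R x + r *\<^sub>R y + t *\<^sub>R e"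
        by (simp add: algebra_simps)
      finally show "q ((1 - r) *\<^sub>R x + r *\<^sub>R y + t *\<^sub>R e) \<le> (1 - r) * q (x + t *\<^sub>R e) + r * q (y + t *\<^sub>R e)" .
    qed (rule convex_Rd)
    from Suc.IH[OF this] show ?thesis by blast
  qed
  then obtain z where z: "\<And>t. z t \<in> Rd d"
    "\<And>t w. w \<in> Rd d \<Longrightarrow> q (z t + t *\<^sub>R e) + c * (norm (z t))\<^sup>2 \<le> q (w + t *\<^sub>R e) + c * (norm w)\<^sup>2"
    by metis
  define h where "h t = q (z t + t *\<^sub>R e) + c * (norm (z t))\<^sup>2" for t
  have "convex_on UNIV h"
  proof (rule convex_onI)
    fix r s t :: real assume r: "0 < r" "r < 1"
    let ?w = "(1 - r) *\<^sub>R z s + r *\<^sub>R z t"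
    have "h ((1 - r) *\<^sub>R s + r *\<^sub>R t) \<le> q (?w + ((1 - r) *\<^sub>R s + r *\<^sub>R t) *\<^sub>R e) + c * (norm ?w)\<^sup>2"
      unfolding h_def using z by simp
    also have "q (?w + ((1 - r) *\<^sub>R s + r *\<^sub>R t) *\<^sub>R e) = q ((1 - r) *\<^sub>R (z s + s *\<^sub>R e) + r *\<^sub>R (z t + t *\<^sub>R e))"
      by (simp add: algebra_simps)
    also have "\<dots> \<le> (1 - r) * q (z s + s *\<^sub>R e) + r * q (z t + t *\<^sub>R e)"
      using r z e by (intro convex_onD[OF q]) auto
    also have "(norm ?w)\<^sup>2 \<le> (1 - r) * (norm (z s))\<^sup>2 + r * (norm (z t))\<^sup>2"
    proof -
      have "(1 - r) * (norm (z s))\<^sup>2 + r * (norm (z t))\<^sup>2 - (norm ?w)\<^sup>2 = r * (1 - r) * (norm (z s - z t))\<^sup>2"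
        by (simp add: power2_norm_eq_inner inner_diff inner_add inner_commute[of "z t" "z s"] algebra_simps)
      then show ?thesis using r by (smt (verit) mult_nonneg_nonneg zero_le_power2)
    qed
    finally show "h ((1 - r) *\<^sub>R s + r *\<^sub>R t) \<le> (1 - r) * h s + r * h t"
      using c by (simp add: h_def algebra_simps)
  qed simp
  from convex_plus_square_attains_min[OF this c]
  obtain t where t: "\<And>s. h t + c * t\<^sup>2 \<le> h s + c * s\<^sup>2" by blast
  show ?case
  proof (intro bexI ballI)
    show "z t + t *\<^sub>R e \<in> Rd (Suc d)" using z e by simp
    fix w assume "w \<in> Rd (Suc d)"
    then obtain v s where v: "v \<in> Rd d" "w = v + s *\<^sub>R e" using e(5) by blast
    have "h s \<le> q (v + s *\<^sub>R e) + c * (norm v)\<^sup>2" unfolding h_def by (rule z(2)[OF v(1)])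
    with t[of s] show "q (z t + t *\<^sub>R e) + c * (norm (z t + t *\<^sub>R e))\<^sup>2 \<le> q w + c * (norm w)\<^sup>2"
      unfolding v(2) norm_split[OF z(1)] norm_split[OF v(1)] by (simp add: h_def algebra_simps)
  qed
qed

text \<open>Expanding the square reduces the general centre \<open>y\<close> to the origin: the cross term is linear.\<close>

lemma arg_min_on_proximal:
  fixes q :: "rvec \<Rightarrow> real" and y :: rvec
  assumes q: "convex_on (Rd d) q" and c: "c > 0"
  defines "z \<equiv> arg_min_on (\<lambda>w. q w + c * (norm (w - y))\<^sup>2) (Rd d)"
  shows "z \<in> Rd d" "w \<in> Rd d \<Longrightarrow> q z + c * (norm (z - y))\<^sup>2 \<le> q w + c * (norm (w - y))\<^sup>2"
proof -
  have "convex_on (Rd d) (\<lambda>w. q w + (- (2 * c * (y \<bullet> w))))"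
    by (intro convex_on_add q)
       (auto simp: convex_on_def convex_Rd inner_add algebra_simps)
  from convex_plus_norm_attains_min[OF this c]
  obtain v where v: "v \<in> Rd d" "\<And>w. w \<in> Rd d \<Longrightarrow>
      q v - 2 * c * (y \<bullet> v) + c * (norm v)\<^sup>2 \<le> q w - 2 * c * (y \<bullet> w) + c * (norm w)\<^sup>2"
    by auto
  have expand: "c * (norm (w - y))\<^sup>2 = c * (norm w)\<^sup>2 - 2 * c * (y \<bullet> w) + c * (norm y)\<^sup>2" for w
    by (simp add: power2_norm_eq_inner inner_diff inner_commute[of w y] algebra_simps)
  have "is_arg_min (\<lambda>w. q w + c * (norm (w - y))\<^sup>2) (\<lambda>w. w \<in> Rd d) v"
    unfolding is_arg_min_linorder expand using v by fastforce
  then have "is_arg_min (\<lambda>w. q w + c * (norm (w - y))\<^sup>2) (\<lambda>w. w \<in> Rd d) z"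
    unfolding z_def arg_min_on_def arg_min_def by (rule someI)
  then show "z \<in> Rd d" "w \<in> Rd d \<Longrightarrow> q z + c * (norm (z - y))\<^sup>2 \<le> q w + c * (norm (w - y))\<^sup>2"
    by (auto simp: is_arg_min_linorder)
qed


section \<open>Expectations with finitely many outcomes\<close>

lemma expectation_cong_support:
  fixes h k :: "'a \<Rightarrow> real"
  assumes "\<And>x. x \<in> set_pmf p \<Longrightarrow> h x = k x"
  shows "measure_pmf.expectation p h = measure_pmf.expectation p k"
  using assms by (intro integral_cong_AE) (auto simp: AE_measure_pmf_iff)

lemma expectation_mono_support:
  fixes h k :: "'a \<Rightarrow> real"
  assumes "finite (set_pmf p)" "\<And>x. x \<in> set_pmf p \<Longrightarrow> h x \<le> k x"
  shows "measure_pmf.expectation p h \<le> measure_pmf.expectation p k"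
  using assms by (intro integral_mono_AE integrable_measure_pmf_finite) (auto simp: AE_measure_pmf_iff)

lemma expectation_bind_finite:
  fixes h :: "'b \<Rightarrow> real"
  assumes "finite (set_pmf p)" "\<And>x. x \<in> set_pmf p \<Longrightarrow> finite (set_pmf (f x))"
  shows "measure_pmf.expectation (p \<bind> f) h
    = measure_pmf.expectation p (\<lambda>x. measure_pmf.expectation (f x) h)"
  using assms
  by (simp add: pmf_expectation_bind[of "set_pmf p"] integral_measure_pmf_real[of "set_pmf p"] mult.commute)

lemma expectation_bind_le:
  fixes h :: "'b \<Rightarrow> real"
  assumes "finite (set_pmf p)" "\<And>x. x \<in> set_pmf p \<Longrightarrow> finite (set_pmf (f x))"
    "\<And>x. x \<in> set_pmf p \<Longrightarrow> measure_pmf.expectation (f x) h \<le> k x"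
  shows "measure_pmf.expectation (p \<bind> f) h \<le> measure_pmf.expectation p k"
  using assms by (auto simp: expectation_bind_finite intro!: expectation_mono_support)

lemma expectation_affine:
  fixes h :: "'a \<Rightarrow> real"
  assumes "finite (set_pmf p)"
  shows "measure_pmf.expectation p (\<lambda>x. c + a * h x) = c + a * measure_pmf.expectation p h"
  using integrable_measure_pmf_finite[OF assms, of h] by simp

lemma expectation_add_finite:
  fixes h k :: "'a \<Rightarrow> real"
  assumes "finite (set_pmf p)"
  shows "measure_pmf.expectation p (\<lambda>x. h x + k x)
    = measure_pmf.expectation p h + measure_pmf.expectation p k"
  using assms by (intro Bochner_Integration.integral_add integrable_measure_pmf_finite)

lemma finite_set_replicate_pmf: "finite (set_pmf Q) \<Longrightarrow> finite (set_pmf (replicate_pmf b Q))"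
  by (induction b) auto

text \<open>
  Independent errors of mean zero are orthogonal in expectation, so their second moments add. The
  statement that a vector has mean zero is made through its inner products, which makes sense in
  incomplete spaces as well.
\<close>

lemma independent_sum_moments:
  fixes \<xi> :: "'i \<Rightarrow> 'a::real_inner"
  assumes Q: "finite (set_pmf Q)" and \<xi>: "\<And>w. measure_pmf.expectation Q (\<lambda>i. \<xi> i \<bullet> w) = 0"
  shows "measure_pmf.expectation (replicate_pmf b Q) (\<lambda>I. (\<Sum>i\<leftarrow>I. \<xi> i) \<bullet> w) = 0" (is "?M b w")
    and "measure_pmf.expectation (replicate_pmf b Q) (\<lambda>I. (norm (\<Sum>i\<leftarrow>I. \<xi> i))\<^sup>2)
      = real b * measure_pmf.expectation Q (\<lambda>i. (norm (\<xi> i))\<^sup>2)" (is "?V b")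
proof -
  note fin = finite_set_replicate_pmf[OF Q] Q
  have step: "measure_pmf.expectation (replicate_pmf (Suc b) Q) h =
      measure_pmf.expectation Q (\<lambda>i. measure_pmf.expectation (replicate_pmf b Q) (\<lambda>I. h (i # I)))"
    for b and h :: "'i list \<Rightarrow> real"
    using fin by (simp add: expectation_bind_finite)
  have mean: "?M b w" for b w
  proof (induction b)
    case (Suc b)
    then show ?case
      using \<xi>[of w] expectation_affine[OF fin(1), of b _ 1 "\<lambda>I. (\<Sum>i\<leftarrow>I. \<xi> i) \<bullet> w"]
      by (simp only: step list.map sum_list.Cons inner_add_left mult_1 add_0_right)
  qed simp
  then show "?M b w" .
  show "?V b"
  proof (induction b)
    case (Suc b)
    let ?s = "measure_pmf.expectation Q (\<lambda>i. (norm (\<xi> i))\<^sup>2)"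
    have "measure_pmf.expectation (replicate_pmf b Q) (\<lambda>I. (norm (\<xi> i + (\<Sum>i\<leftarrow>I. \<xi> i)))\<^sup>2)
        = (norm (\<xi> i))\<^sup>2 + real b * ?s" for i
    proof -
      have "measure_pmf.expectation (replicate_pmf b Q) (\<lambda>I. (norm (\<xi> i + (\<Sum>i\<leftarrow>I. \<xi> i)))\<^sup>2)
        = measure_pmf.expectation (replicate_pmf b Q)
            (\<lambda>I. ((norm (\<xi> i))\<^sup>2 + 2 * ((\<Sum>i\<leftarrow>I. \<xi> i) \<bullet> \<xi> i)) + (norm (\<Sum>i\<leftarrow>I. \<xi> i))\<^sup>2)"
        by (intro expectation_cong_support)
          (simp add: power2_norm_eq_inner inner_add_left inner_add_right inner_commute[of "\<xi> i" "sum_list _"])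
      also have "\<dots> = (norm (\<xi> i))\<^sup>2 + real b * ?s"
        unfolding expectation_add_finite[OF fin(1)] expectation_affine[OF fin(1)] Suc
        by (simp add: mean)
      finally show ?thesis .
    qed
    then show ?case
      using expectation_affine[OF Q, of "real b * ?s" 1 "\<lambda>i. (norm (\<xi> i))\<^sup>2"]
      by (simp add: step del: replicate_pmf.simps add: algebra_simps)
  qed simp
qed

text \<open>Centring can only decrease the second moment, hence the bound by the uncentred one.\<close>

lemma minibatch_mean_moments:
  fixes \<zeta> :: "'i \<Rightarrow> 'a::real_inner"
  assumes Q: "finite (set_pmf Q)" and \<zeta>: "\<And>w. measure_pmf.expectation Q (\<lambda>i. \<zeta> i \<bullet> w) = v \<bullet> w"
    and b: "b \<ge> 1"
  shows "measure_pmf.expectation (replicate_pmf b Q)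
      (\<lambda>I. ((1 / real b) *\<^sub>R (\<Sum>i\<leftarrow>I. \<zeta> i) - v) \<bullet> w) = 0"
    and "measure_pmf.expectation (replicate_pmf b Q)
        (\<lambda>I. (norm ((1 / real b) *\<^sub>R (\<Sum>i\<leftarrow>I. \<zeta> i) - v))\<^sup>2)
      \<le> 1 / real b * measure_pmf.expectation Q (\<lambda>i. (norm (\<zeta> i))\<^sup>2)"
proof -
  define \<xi> where "\<xi> i = \<zeta> i - v" for i
  have sum: "(\<Sum>i\<leftarrow>I. \<xi> i) = (\<Sum>i\<leftarrow>I. \<zeta> i) - real (length I) *\<^sub>R v" for I
    by (induction I) (simp_all add: \<xi>_def algebra_simps)
  have len: "(1 / real b) *\<^sub>R (\<Sum>i\<leftarrow>I. \<zeta> i) - v = (1 / real b) *\<^sub>R (\<Sum>i\<leftarrow>I. \<xi> i)"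
    if "I \<in> set_pmf (replicate_pmf b Q)" for I
    using that b by (simp add: sum set_replicate_pmf scaleR_diff_right)
  have int: "integrable (measure_pmf Q) h" for h :: "'i \<Rightarrow> real"
    by (rule integrable_measure_pmf_finite[OF Q])
  have \<xi>0: "measure_pmf.expectation Q (\<lambda>i. \<xi> i \<bullet> w) = 0" for w
    using \<zeta>[of w] int by (simp add: \<xi>_def inner_diff_left)
  note mom = independent_sum_moments[OF Q \<xi>0]
  show "measure_pmf.expectation (replicate_pmf b Q)
      (\<lambda>I. ((1 / real b) *\<^sub>R (\<Sum>i\<leftarrow>I. \<zeta> i) - v) \<bullet> w) = 0"
  proof -
    have "measure_pmf.expectation (replicate_pmf b Q)
        (\<lambda>I. ((1 / real b) *\<^sub>R (\<Sum>i\<leftarrow>I. \<zeta> i) - v) \<bullet> w)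
      = measure_pmf.expectation (replicate_pmf b Q) (\<lambda>I. 0 + 1 / real b * ((\<Sum>i\<leftarrow>I. \<xi> i) \<bullet> w))"
      by (intro expectation_cong_support) (simp add: len)
    then show ?thesis
      unfolding expectation_affine[OF finite_set_replicate_pmf[OF Q]] by (simp add: mom(1))
  qed
  have "measure_pmf.expectation Q (\<lambda>i. (norm (\<xi> i))\<^sup>2)
      = measure_pmf.expectation Q (\<lambda>i. (norm (\<zeta> i))\<^sup>2 + ((norm v)\<^sup>2 + (- 2) * (\<zeta> i \<bullet> v)))"
    by (intro expectation_cong_support)
      (simp add: \<xi>_def power2_norm_eq_inner inner_diff_left inner_diff_right inner_commute[of v "\<zeta> _"])
  also have "\<dots> = measure_pmf.expectation Q (\<lambda>i. (norm (\<zeta> i))\<^sup>2) - (norm v)\<^sup>2"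
    unfolding expectation_add_finite[OF Q] expectation_affine[OF Q]
    by (simp add: power2_norm_eq_inner \<zeta>)
  finally have "measure_pmf.expectation Q (\<lambda>i. (norm (\<xi> i))\<^sup>2)
      \<le> measure_pmf.expectation Q (\<lambda>i. (norm (\<zeta> i))\<^sup>2)" by simp
  then have "1 / (real b)\<^sup>2 * (real b * measure_pmf.expectation Q (\<lambda>i. (norm (\<xi> i))\<^sup>2))
      \<le> 1 / real b * measure_pmf.expectation Q (\<lambda>i. (norm (\<zeta> i))\<^sup>2)"
    using b by (simp add: power2_eq_square divide_right_mono)
  moreover have "measure_pmf.expectation (replicate_pmf b Q)
        (\<lambda>I. (norm ((1 / real b) *\<^sub>R (\<Sum>i\<leftarrow>I. \<zeta> i) - v))\<^sup>2)
      = measure_pmf.expectation (replicate_pmf b Q)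
        (\<lambda>I. 1 / (real b)\<^sup>2 * (norm (\<Sum>i\<leftarrow>I. \<xi> i))\<^sup>2)"
    by (intro expectation_cong_support) (simp add: len power_mult_distrib power_divide)
  ultimately show "measure_pmf.expectation (replicate_pmf b Q)
        (\<lambda>I. (norm ((1 / real b) *\<^sub>R (\<Sum>i\<leftarrow>I. \<zeta> i) - v))\<^sup>2)
      \<le> 1 / real b * measure_pmf.expectation Q (\<lambda>i. (norm (\<zeta> i))\<^sup>2)"
    by (simp add: mom(2))
qed


section \<open>Finite sums plus a convex regulariser\<close>

lemma avg_mono: "(\<And>i. i \<in> {1..n} \<Longrightarrow> a i \<le> c i) \<Longrightarrow> avg n a \<le> avg n c"
  unfolding avg_def by (intro mult_left_mono sum_mono) auto

lemma avg_cong: "(\<And>i. i \<in> {1..n} \<Longrightarrow> a i = c i) \<Longrightarrow> avg n a = avg n c"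
  by (simp add: avg_def)

lemma avg_add: "avg n (\<lambda>i. a i + c i) = avg n a + avg n c"
  by (simp add: avg_def sum.distrib distrib_left)

lemma avg_scale: "avg n (\<lambda>i. r * a i) = r * avg n a"
  by (simp add: avg_def sum_distrib_left)

locale composite_problem =
  fixes d n :: nat and f :: "nat \<Rightarrow> rvec \<Rightarrow> real" and L :: "nat \<Rightarrow> real" and R :: "rvec \<Rightarrow> real"
  assumes n_pos: "n \<ge> 1"
    and L_pos: "\<And>i. i \<in> {1..n} \<Longrightarrow> L i > 0"
    and f_convex: "\<And>i. i \<in> {1..n} \<Longrightarrow> convex_on (Rd d) (f i)"
    and f_smooth: "\<And>i. i \<in> {1..n} \<Longrightarrow> smooth d (L i) (f i)"
    and R_convex: "convex_on (Rd d) R"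
begin

abbreviation "g i \<equiv> gradient d (f i)"
abbreviation "F \<equiv> avg_fun n f"
abbreviation "gF \<equiv> gradient d (avg_fun n f)"
abbreviation "Lbar \<equiv> avg n L"

definition "P x = F x + R x"

definition "lin y x = F y + gF y \<bullet> (x - y)"

text \<open>
  The second moment of the sampled gradient differences, up to the factor \<open>Lbar\<close>. It behaves like a
  squared distance and is at most twice the Bregman distance.
\<close>

definition "gap x y = avg n (\<lambda>i. (norm (g i x - g i y))\<^sup>2 / L i)"

lemma Lbar_pos: "Lbar > 0"
proof -
  have "(\<Sum>i=1..n. L i) > 0" using n_pos L_pos by (intro sum_pos) auto
  then show ?thesis using n_pos by (simp add: avg_def)
qed

lemma g_facts:
  assumes "i \<in> {1..n}" "x \<in> Rd d"
  shows "g i x \<in> Rd d" "(f i has_derivative (\<lambda>h. g i x \<bullet> h)) (at x within Rd d)"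
    "y \<in> Rd d \<Longrightarrow> norm (g i x - g i y) \<le> L i * norm (x - y)"
  using gradient_exists[of "f i" d x] f_smooth[OF assms(1)] assms(2) by (auto simp: smooth_def)

lemma F_has_derivative_avg:
  assumes x: "x \<in> Rd d"
  shows "(F has_derivative (\<lambda>h. ((1 / real n) *\<^sub>R (\<Sum>i=1..n. g i x)) \<bullet> h)) (at x within Rd d)"
proof -
  have "((\<lambda>x. 1 / real n * (\<Sum>i=1..n. f i x)) has_derivative
      (\<lambda>h. 1 / real n * (\<Sum>i=1..n. g i x \<bullet> h))) (at x within Rd d)"
    using g_facts(2)[OF _ x] by (intro has_derivative_mult_right has_derivative_sum) auto
  then show ?thesis
    unfolding avg_fun_def avg_def by (simp add: inner_sum_left)
qed

lemma gF_eq: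
  assumes x: "x \<in> Rd d"
  shows "gF x = (1 / real n) *\<^sub>R (\<Sum>i=1..n. g i x)"
proof (rule gradient_eqI[OF x _ F_has_derivative_avg[OF x]])
  show "(1 / real n) *\<^sub>R (\<Sum>i=1..n. g i x) \<in> Rd d"
    using g_facts(1)[OF _ x] by (intro subspace_scale[OF subspace_Rd] subspace_sum[OF subspace_Rd]) auto
qed

lemma F_has_derivative: "x \<in> Rd d \<Longrightarrow> (F has_derivative (\<lambda>h. gF x \<bullet> h)) (at x within Rd d)"
  using F_has_derivative_avg by (simp add: gF_eq)

lemma gF_in: "x \<in> Rd d \<Longrightarrow> gF x \<in> Rd d"
  using g_facts(1) by (auto simp: gF_eq intro!: subspace_scale[OF subspace_Rd] subspace_sum[OF subspace_Rd])

lemma gF_inner: "x \<in> Rd d \<Longrightarrow> gF x \<bullet> w = avg n (\<lambda>i. g i x \<bullet> w)"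
  by (simp add: gF_eq avg_def inner_sum_left)

lemma lin_avg: "y \<in> Rd d \<Longrightarrow> lin y x = avg n (\<lambda>i. f i y + g i y \<bullet> (x - y))"
  by (simp add: lin_def avg_add avg_fun_def gF_inner)

lemma lin_affine: "lin y ((1 - t) *\<^sub>R u + t *\<^sub>R v) = (1 - t) * lin y u + t * lin y v"
  by (simp add: lin_def inner_diff_right inner_add_right algebra_simps)

lemma lin_le_F: "x \<in> Rd d \<Longrightarrow> y \<in> Rd d \<Longrightarrow> lin y x \<le> F x"
  unfolding lin_avg avg_fun_def
  by (intro avg_mono convex_on_above_gradient[OF subspace_Rd _ _ f_convex g_facts(2)])

lemma F_le_lin: "x \<in> Rd d \<Longrightarrow> y \<in> Rd d \<Longrightarrow> F x \<le> lin y x + Lbar / 2 * (norm (x - y))\<^sup>2"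
proof -
  assume xy: "x \<in> Rd d" "y \<in> Rd d"
  have "F x \<le> avg n (\<lambda>i. (f i y + g i y \<bullet> (x - y)) + ((norm (x - y))\<^sup>2 / 2) * L i)"
    unfolding avg_fun_def
  proof (rule avg_mono)
    fix i assume i: "i \<in> {1..n}"
    from smooth_below_quadratic[OF subspace_Rd xy(2,1) g_facts(2,3)[OF i]]
    show "f i x \<le> (f i y + g i y \<bullet> (x - y)) + ((norm (x - y))\<^sup>2 / 2) * L i"
      by (simp add: mult.commute)
  qed
  then show ?thesis
    unfolding avg_add[of n "\<lambda>i. f i y + g i y \<bullet> (x - y)"] avg_scale lin_avg[OF xy(2)] by (simp add: mult.commute)
qed

lemma gap_le_Bregman: "x \<in> Rd d \<Longrightarrow> y \<in> Rd d \<Longrightarrow> gap x y \<le> 2 * (F x - lin y x)"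
proof -
  assume xy: "x \<in> Rd d" "y \<in> Rd d"
  have "gap x y \<le> avg n (\<lambda>i. 2 * (f i x + (- 1) * (f i y + g i y \<bullet> (x - y))))"
    unfolding gap_def
  proof (rule avg_mono)
    fix i assume i: "i \<in> {1..n}"
    from gradient_difference_le_Bregman[OF subspace_Rd xy f_convex[OF i] L_pos[OF i] g_facts(2,1,3)[OF i]]
    show "(norm (g i x - g i y))\<^sup>2 / L i \<le> 2 * (f i x + (- 1) * (f i y + g i y \<bullet> (x - y)))"
      by simp
  qed
  then show ?thesis
    unfolding avg_scale avg_add[of n "\<lambda>i. f i x"] lin_avg[OF xy(2)] avg_fun_def by simp
qed

lemma gap_triangle: "gap x y \<le> 2 * gap x z + 2 * gap z y"
proof -
  have "gap x y \<le> avg n (\<lambda>i. 2 * ((norm (g i x - g i z))\<^sup>2 / L i) + 2 * ((norm (g i z - g i y))\<^sup>2 / L i))"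
    unfolding gap_def
  proof (rule avg_mono)
    fix i assume i: "i \<in> {1..n}"
    let ?a = "norm (g i x - g i z)" and ?c = "norm (g i z - g i y)"
    have "norm (g i x - g i y) \<le> ?a + ?c" using norm_triangle_ineq[of "g i x - g i z" "g i z - g i y"] by simp
    then have "(norm (g i x - g i y))\<^sup>2 \<le> (?a + ?c)\<^sup>2" by (rule power_mono) simp
    also have "\<dots> \<le> 2 * ?a\<^sup>2 + 2 * ?c\<^sup>2"
      using sum_squares_bound[of ?a ?c] by (simp add: power2_sum)
    finally show "(norm (g i x - g i y))\<^sup>2 / L i \<le> 2 * (?a\<^sup>2 / L i) + 2 * (?c\<^sup>2 / L i)"
      using L_pos[OF i] by (simp add: field_simps)
  qed
  then show ?thesis unfolding avg_add avg_scale gap_def .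
qed

lemma Bregman_at_minimizer:
  assumes xs: "xs \<in> Rd d" "\<And>x. x \<in> Rd d \<Longrightarrow> P xs \<le> P x" and x: "x \<in> Rd d"
  shows "F x - lin xs x \<le> P x - P xs"
  using composite_minimizer_subgradient[OF subspace_Rd xs(1) x R_convex F_has_derivative[OF xs(1)]] xs(2)
  by (simp add: P_def lin_def)


section \<open>The sampled gradient estimator\<close>

abbreviation "Q \<equiv> sampling_pmf n L"

lemma pmf_Q: "i \<in> {1..n} \<Longrightarrow> pmf Q i = L i / (real n * Lbar)"
  using pmf_sampling_pmf[OF n_pos L_pos] by simp

lemma set_Q: "set_pmf Q \<subseteq> {1..n}"
  using pmf_sampling_pmf[OF n_pos L_pos] by (auto simp: set_pmf_iff split: if_splits)

lemma finite_Q: "finite (set_pmf Q)"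
  by (rule finite_subset[OF set_Q]) simp

lemma expectation_Q:
  fixes h :: "nat \<Rightarrow> real"
  shows "measure_pmf.expectation Q h = avg n (\<lambda>i. L i / Lbar * h i)"
proof -
  have "measure_pmf.expectation Q h = (\<Sum>i=1..n. h i * pmf Q i)"
    using set_Q by (intro integral_measure_pmf_real) auto
  also have "\<dots> = (\<Sum>i=1..n. 1 / real n * (L i / Lbar * h i))"
    by (intro sum.cong refl) (simp add: pmf_Q)
  finally show ?thesis by (simp add: avg_def sum_distrib_left)
qed

definition "grad_est xt b y I = (1 / real b) *\<^sub>R
    (\<Sum>i\<leftarrow>I. (1 / (real n * pmf Q i)) *\<^sub>R (g i y - g i xt)) + gF xt"

lemma grad_est_in:
  assumes "xt \<in> Rd d" "y \<in> Rd d" "set I \<subseteq> {1..n}"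
  shows "grad_est xt b y I \<in> Rd d"
proof -
  have "(\<Sum>i\<leftarrow>I. (1 / (real n * pmf Q i)) *\<^sub>R (g i y - g i xt)) \<in> Rd d"
    using assms(3) by (induction I) (use assms g_facts(1) in auto)
  then show ?thesis using gF_in[OF assms(1)] by (simp add: grad_est_def)
qed

text \<open>
  Sampling proportionally to the smoothness constants makes the weight of each squared gradient
  difference inversely proportional to its constant, as in \<open>gap\<close>.
\<close>

lemma grad_est_moments:
  assumes xt: "xt \<in> Rd d" and y: "y \<in> Rd d" and b: "b \<ge> 1"
  shows "measure_pmf.expectation (replicate_pmf b Q) (\<lambda>I. (gF y - grad_est xt b y I) \<bullet> w) = 0"
    and "measure_pmf.expectation (replicate_pmf b Q) (\<lambda>I. (norm (gF y - grad_est xt b y I))\<^sup>2)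
      \<le> Lbar / real b * gap xt y"
proof -
  define \<zeta> where "\<zeta> i = (1 / (real n * pmf Q i)) *\<^sub>R (g i y - g i xt)" for i
  have \<zeta>: "\<zeta> i = (Lbar / L i) *\<^sub>R (g i y - g i xt)" if "i \<in> {1..n}" for i
    using n_pos by (simp add: \<zeta>_def pmf_Q[OF that])
  have mean: "measure_pmf.expectation Q (\<lambda>i. \<zeta> i \<bullet> w) = (gF y - gF xt) \<bullet> w" for w
  proof -
    have "measure_pmf.expectation Q (\<lambda>i. \<zeta> i \<bullet> w) = avg n (\<lambda>i. g i y \<bullet> w + (- 1) * (g i xt \<bullet> w))"
      unfolding expectation_Q
    proof (rule avg_cong)
      fix i assume i: "i \<in> {1..n}"
      show "L i / Lbar * (\<zeta> i \<bullet> w) = g i y \<bullet> w + (- 1) * (g i xt \<bullet> w)"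
        using Lbar_pos L_pos[OF i] by (simp add: \<zeta>[OF i] inner_diff_left)
    qed
    also have "\<dots> = (gF y - gF xt) \<bullet> w"
      unfolding avg_add avg_scale by (simp add: inner_diff_left gF_inner xt y)
    finally show ?thesis .
  qed
  have second: "measure_pmf.expectation Q (\<lambda>i. (norm (\<zeta> i))\<^sup>2) = Lbar * gap xt y"
    unfolding expectation_Q gap_def avg_scale[symmetric]
  proof (rule avg_cong)
    fix i assume i: "i \<in> {1..n}"
    show "L i / Lbar * (norm (\<zeta> i))\<^sup>2 = Lbar * ((norm (g i xt - g i y))\<^sup>2 / L i)"
      using Lbar_pos L_pos[OF i]
      by (simp add: \<zeta>[OF i] power_mult_distrib power_divide norm_minus_commute[of "g i y"])
        (simp add: power2_eq_square)
  qed
  have est: "gF y - grad_est xt b y I = - ((1 / real b) *\<^sub>R (\<Sum>i\<leftarrow>I. \<zeta> i) - (gF y - gF xt))" for I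
    by (simp add: grad_est_def \<zeta>_def)
  show "measure_pmf.expectation (replicate_pmf b Q) (\<lambda>I. (gF y - grad_est xt b y I) \<bullet> w) = 0"
    unfolding est inner_minus_left using minibatch_mean_moments(1)[OF finite_Q mean b] by simp
  show "measure_pmf.expectation (replicate_pmf b Q) (\<lambda>I. (norm (gF y - grad_est xt b y I))\<^sup>2)
      \<le> Lbar / real b * gap xt y"
    unfolding est norm_minus_cancel using minibatch_mean_moments(2)[OF finite_Q mean b]
    by (simp add: second)
qed

end


section \<open>One stage: accelerated dual averaging with variance reduction\<close>

text \<open>
  Iteration \<open>k\<close> has weight \<open>k / 2\<close> in the dual average, and \<open>theta k\<close> is the sum of the first \<open>k\<close> weights
  divided by the last one.
\<close>

definition weight_sum :: "nat \<Rightarrow> real" where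
  "weight_sum k = real k * (real k + 1) / 4"

lemma weight_sum_Suc: "weight_sum (Suc k) = weight_sum k + (real k + 1) / 2"
  by (simp add: weight_sum_def field_simps)

lemma weight_sum_theta:
  "weight_sum (Suc k) * (1 / theta (Suc k)) = (real k + 1) / 2"
  "weight_sum (Suc k) * (1 - 1 / theta (Suc k)) = weight_sum k"
  "theta (Suc k) * theta k = weight_sum (Suc k)"
  "0 < 1 / theta (Suc k)" "1 / theta (Suc k) \<le> 1"
  by (simp_all add: weight_sum_def theta_def field_simps)

text \<open>
  The step size belongs to stage length \<open>M\<close>, but the stage may be shorter: all warm-start stages run
  with the step size of the final stage length. The point \<open>x\<close> is an arbitrary comparison point.
\<close>

locale accsvrda_stage = composite_problem +
  fixes yt xt x :: rvec and \<eta> \<gamma> :: real and b M :: nat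
  assumes yt: "yt \<in> Rd d" and xt: "xt \<in> Rd d" and x: "x \<in> Rd d"
    and b: "b \<ge> 1" and \<gamma>: "\<gamma> > 0" and \<eta>: "\<eta> = step_size n L \<gamma> M b"
begin

text \<open>
  The part of \<open>1 / (2 \<eta>)\<close> that smoothness does not use up. It absorbs the gradient noise.
\<close>

definition "\<kappa> = \<gamma> * (real M + 1) / real b * Lbar / 2"

lemma \<kappa>_pos: "\<kappa> > 0"
  using \<gamma> b Lbar_pos by (auto simp: \<kappa>_def intro!: mult_pos_pos divide_pos_pos)

lemma \<eta>_eq: "1 / (2 * \<eta>) = Lbar / 2 + \<kappa>"
  by (simp add: \<eta> step_size_def \<kappa>_def algebra_simps add_divide_distrib)

lemma \<eta>_pos: "\<eta> > 0"
proof -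
  have "1 / (2 * \<eta>) > 0" unfolding \<eta>_eq using Lbar_pos \<kappa>_pos by simp
  then show ?thesis by (simp add: zero_less_divide_iff)
qed

text \<open>
  The function minimised by the dual averaging step, scaled by the weight sum, so that each
  iteration adds one weighted term to it.
\<close>

definition "model k h w = weight_sum k * (h \<bullet> w + R w) + 1 / (2 * \<eta>) * (norm (w - yt))\<^sup>2"

definition "valid k = (\<lambda>(u, z, h). u \<in> Rd d \<and> z \<in> Rd d \<and> h \<in> Rd d \<and>
  (\<forall>w\<in>Rd d. model k h z + 1 / (2 * \<eta>) * (norm (w - z))\<^sup>2 \<le> model k h w))"

text \<open>
  The estimate sequence argument compares the weighted objective with the minimum of a model that
  also contains the accumulated constants of the linearisations. Those constants depend on the whole
  history, but they cancel in the difference of two model values. The difference to the value at the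
  comparison point \<open>x\<close> is therefore a function of the current state.
\<close>

definition "merit k = (\<lambda>(u, z, h). weight_sum k * P u + model k h x - model k h z)"

definition "extrap k u z = (1 - 1 / theta k) *\<^sub>R u + (1 / theta k) *\<^sub>R (z :: rvec)"

lemma extrap_in: "u \<in> Rd d \<Longrightarrow> z \<in> Rd d \<Longrightarrow> extrap k u z \<in> Rd d"
  by (simp add: extrap_def)

lemma merit_lower:
  assumes "valid k (u, z, h)"
  shows "weight_sum k * P u + 1 / (2 * \<eta>) * (norm (x - z))\<^sup>2 \<le> merit k (u, z, h)"
  using assms x by (auto simp: valid_def merit_def dest!: bspec[of _ _ x])

lemma model_Suc:
  "model (Suc k) (extrap (Suc k) h g') w = model k h w + (real k + 1) / 2 * (g' \<bullet> w + R w)"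
proof -
  let ?t = "1 / theta (Suc k)" and ?A = "weight_sum (Suc k)"
  have "?A * (extrap (Suc k) h g' \<bullet> w + R w) =
      (?A * (1 - ?t)) * (h \<bullet> w) + (?A * ?t) * (g' \<bullet> w) + ?A * R w"
    by (simp add: extrap_def inner_add_left algebra_simps)
  also have "\<dots> = weight_sum k * (h \<bullet> w + R w) + (real k + 1) / 2 * (g' \<bullet> w + R w)"
    unfolding weight_sum_theta by (simp only: weight_sum_Suc distrib_left distrib_right ac_simps)
  finally show ?thesis by (simp add: model_def)
qed

lemma convex_inner_plus_R: "convex_on (Rd d) (\<lambda>w. h \<bullet> w + R w)"
  by (intro convex_on_add R_convex)
     (auto simp: convex_on_def convex_Rd inner_add algebra_simps)

text \<open>
  The model grows by one linear term and its minimiser moves by \<open>v = z' - z\<close>. The growth of the old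
  model around \<open>z\<close> pays for two terms of order \<open>|v|\<^sup>2\<close>: the smoothness error and, by Young's
  inequality, the correlation of the gradient error \<open>\<delta>\<close> with \<open>v\<close>. The remaining correlation of \<open>\<delta>\<close>
  is with \<open>z - x\<close>, which is independent of the current sample.
\<close>

lemma step_valid_and_merit:
  assumes st: "valid k (u, z, h)" and I: "set I \<subseteq> {1..n}"
  defines "y \<equiv> extrap (Suc k) u z" and "a \<equiv> (real k + 1) / 2"
  defines "\<delta> \<equiv> gF y - grad_est xt b y I"
  defines "st' \<equiv> accsvrda_step d n f R yt xt \<eta> b Q (Suc k) I (u, z, h)"
  shows "valid (Suc k) st'"
    and "merit (Suc k) st' \<le> merit k (u, z, h) + a * (lin y x + R x) + a * (\<delta> \<bullet> (z - x))
           + a\<^sup>2 / (4 * \<kappa>) * (norm \<delta>)\<^sup>2"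
proof -
  have in_Rd: "u \<in> Rd d" "z \<in> Rd d" "h \<in> Rd d"
    and growth: "\<And>w. w \<in> Rd d \<Longrightarrow> model k h z + 1 / (2 * \<eta>) * (norm (w - z))\<^sup>2 \<le> model k h w"
    using st by (auto simp: valid_def)
  define t where "t = 1 / theta (Suc k)"
  let ?A = "weight_sum k" and ?A' = "weight_sum (Suc k)"
  have t: "?A' * t = a" "?A' * (1 - t) = ?A" "0 < t" "t \<le> 1"
    unfolding t_def a_def by (rule weight_sum_theta)+
  have A': "?A' > 0" by (simp add: weight_sum_def)
  define g' where "g' = grad_est xt b y I"
  define h' where "h' = extrap (Suc k) h g'"
  define c where "c = 1 / (2 * \<eta> * ?A')"
  define z' where "z' = arg_min_on (\<lambda>w. (h' \<bullet> w + R w) + c * (norm (w - yt))\<^sup>2) (Rd d)"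
  define u' where "u' = extrap (Suc k) u z'"
  have y: "y \<in> Rd d" unfolding y_def using in_Rd by (simp add: extrap_in)
  have g': "g' \<in> Rd d" unfolding g'_def by (rule grad_est_in[OF xt y I])
  have h': "h' \<in> Rd d" unfolding h'_def using in_Rd g' by (simp add: extrap_in)
  have st': "st' = (u', z', h')"
    unfolding st'_def accsvrda_step_def u'_def z'_def h'_def g'_def grad_est_def c_def y_def extrap_def
    by (simp add: Let_def mult.assoc weight_sum_theta(3))
  have c: "c > 0" using A' \<eta>_pos by (simp add: c_def)
  note prox = arg_min_on_proximal[OF convex_inner_plus_R[of h'] c, where y = yt, folded z'_def]
  have z': "z' \<in> Rd d" by (rule prox(1))
  have u': "u' \<in> Rd d" unfolding u'_def using in_Rd z' by (simp add: extrap_in)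
  have growth': "model (Suc k) h' z' + 1 / (2 * \<eta>) * (norm (w - z'))\<^sup>2 \<le> model (Suc k) h' w"
    if w: "w \<in> Rd d" for w
  proof -
    from proximal_minimizer_growth[OF subspace_Rd z' w convex_inner_plus_R prox(2)]
    have "?A' * ((h' \<bullet> z' + R z') + c * (norm (z' - yt))\<^sup>2 + c * (norm (w - z'))\<^sup>2)
        \<le> ?A' * ((h' \<bullet> w + R w) + c * (norm (w - yt))\<^sup>2)"
      using A' by (simp only: mult_le_cancel_left_pos)
    moreover have "?A' * (c * s) = 1 / (2 * \<eta>) * s" for s using A' by (simp add: c_def)
    ultimately show ?thesis by (simp only: model_def distrib_left)
  qed
  show "valid (Suc k) st'" unfolding st' valid_def using u' z' h' growth' by simp
  define v where "v = z' - z"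
  have F: "?A' * F u' \<le> ?A * F u + a * lin y z' + Lbar / 2 * (norm v)\<^sup>2"
  proof -
    have "?A' * F u' \<le> ?A' * (lin y u' + Lbar / 2 * (norm (u' - y))\<^sup>2)"
      using F_le_lin[OF u' y] A' by simp
    also have "\<dots> = ?A * lin y u + a * lin y z' + Lbar / 2 * (?A' * (norm (u' - y))\<^sup>2)"
      unfolding u'_def extrap_def lin_affine t_def[symmetric]
      by (simp add: t(1,2)[symmetric] algebra_simps)
    also have "u' - y = t *\<^sub>R v"
      unfolding u'_def y_def extrap_def v_def t_def by (simp add: algebra_simps)
    also have "?A' * (norm (t *\<^sub>R v))\<^sup>2 = (a * t) * (norm v)\<^sup>2"
      by (simp add: t(1)[symmetric] power_mult_distrib power2_eq_square[of t])
    finally have "?A' * F u' \<le> ?A * lin y u + a * lin y z' + Lbar / 2 * ((a * t) * (norm v)\<^sup>2)" .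
    moreover have "a * t \<le> 1" by (simp add: a_def t_def theta_def field_simps)
    then have "Lbar / 2 * ((a * t) * (norm v)\<^sup>2) \<le> Lbar / 2 * (1 * (norm v)\<^sup>2)"
      using Lbar_pos by (intro mult_left_mono mult_right_mono) auto
    moreover have "?A * lin y u \<le> ?A * F u"
      by (intro mult_left_mono lin_le_F in_Rd y) (simp add: weight_sum_def)
    ultimately show ?thesis by simp
  qed
  have "?A' * R u' \<le> ?A' * ((1 - t) * R u + t * R z')"
    unfolding u'_def extrap_def t_def[symmetric] using t(3,4) A'
    by (intro mult_left_mono convex_onD[OF R_convex] in_Rd z') auto
  also have "\<dots> = (?A' * (1 - t)) * R u + (?A' * t) * R z'" by (simp add: algebra_simps)
  finally have R: "?A' * R u' \<le> ?A * R u + a * R z'" unfolding t(1,2) .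
  have \<delta>: "\<delta> = gF y - g'" by (simp add: \<delta>_def g'_def)
  have young: "a * (\<delta> \<bullet> v) - \<kappa> * (norm v)\<^sup>2 \<le> a\<^sup>2 / (4 * \<kappa>) * (norm \<delta>)\<^sup>2"
  proof -
    \<comment> \<open>Young's inequality with the balance that uses exactly \<open>\<kappa>\<close> of the quadratic term\<close>
    have "0 \<le> (norm (a *\<^sub>R \<delta> - (2 * \<kappa>) *\<^sub>R v))\<^sup>2 / (4 * \<kappa>)" using \<kappa>_pos by simp
    also have "(norm (a *\<^sub>R \<delta> - (2 * \<kappa>) *\<^sub>R v))\<^sup>2
        = a\<^sup>2 * (norm \<delta>)\<^sup>2 - (4 * \<kappa>) * (a * (\<delta> \<bullet> v) - \<kappa> * (norm v)\<^sup>2)"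
      unfolding power2_norm_eq_inner
      by (simp add: inner_diff inner_commute[of v \<delta>] power2_eq_square algebra_simps)
    finally show ?thesis using \<kappa>_pos by (simp add: diff_divide_distrib)
  qed
  have model': "model (Suc k) h' w = model k h w + a * (g' \<bullet> w + R w)" for w
    unfolding h'_def a_def by (rule model_Suc)
  have "merit (Suc k) st' = ?A' * F u' + ?A' * R u' + model k h x + a * (g' \<bullet> x + R x)
      - model k h z' - a * (g' \<bullet> z' + R z')"
    by (simp add: st' merit_def model' P_def distrib_left)
  also have "\<dots> \<le> (?A * F u + a * lin y z' + Lbar / 2 * (norm v)\<^sup>2) + (?A * R u + a * R z')
      + model k h x + a * (g' \<bullet> x + R x)
      - (model k h z + (Lbar / 2 + \<kappa>) * (norm v)\<^sup>2) - a * (g' \<bullet> z' + R z')"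
    using F R growth[OF z'] unfolding \<eta>_eq v_def by linarith
  also have "\<dots> = merit k (u, z, h) + a * (lin y z' - g' \<bullet> (z' - x) + R x) - \<kappa> * (norm v)\<^sup>2"
    by (simp add: merit_def P_def inner_diff_right algebra_simps)
  also have "lin y z' - g' \<bullet> (z' - x) + R x = lin y x + R x + \<delta> \<bullet> (z - x) + \<delta> \<bullet> v"
    by (simp add: lin_def \<delta> v_def inner_diff_left inner_diff_right)
  finally show "merit (Suc k) st' \<le> merit k (u, z, h) + a * (lin y x + R x) + a * (\<delta> \<bullet> (z - x))
           + a\<^sup>2 / (4 * \<kappa>) * (norm \<delta>)\<^sup>2"
    using young by (simp add: distrib_left)
qed

lemma set_batch: "I \<in> set_pmf (replicate_pmf b Q) \<Longrightarrow> set I \<subseteq> {1..n}"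
  using set_Q by (auto simp: set_replicate_pmf)

abbreviation "state \<equiv> accsvrda_state d n f R yt xt \<eta> b Q"

lemma finite_state: "finite (set_pmf (state k))"
  by (induction k) (auto intro: finite_set_replicate_pmf[OF finite_Q])

lemma state_valid: "st \<in> set_pmf (state k) \<Longrightarrow> valid k st"
proof (induction k arbitrary: st)
  case 0
  then show ?case by (simp add: valid_def model_def weight_sum_def yt)
next
  case (Suc k)
  then show ?case by (auto intro!: step_valid_and_merit(1) set_batch)
qed

lemma gap_nonneg: "gap u v \<ge> 0"
proof -
  have "avg n (\<lambda>_. 0) \<le> gap u v"
    unfolding gap_def using L_pos by (intro avg_mono) (simp add: less_imp_le)
  then show ?thesis by (simp add: avg_def)
qed

text \<open>
  The correlation term has mean zero. In the variance term, the weight \<open>(k + 1) / 2\<close> is at most half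
  of \<open>M + 1\<close>, the factor in the step size, so one of the two weights cancels.
\<close>

lemma merit_expected_step:
  assumes st: "valid k (u, z, h)" and k: "Suc k \<le> M"
    and B: "\<And>y. y \<in> Rd d \<Longrightarrow> lin y x + R x + gap xt y / (4 * \<gamma>) \<le> B"
  shows "measure_pmf.expectation (replicate_pmf b Q)
      (\<lambda>I. merit (Suc k) (accsvrda_step d n f R yt xt \<eta> b Q (Suc k) I (u, z, h)))
    \<le> merit k (u, z, h) + (real k + 1) / 2 * B"
proof -
  define y where "y = extrap (Suc k) u z"
  define a where "a = (real k + 1) / 2"
  define \<delta> where "\<delta> I = gF y - grad_est xt b y I" for I
  note fin = finite_set_replicate_pmf[OF finite_Q, of b]
  have y: "y \<in> Rd d" using st by (auto simp: y_def valid_def intro!: extrap_in)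
  have "measure_pmf.expectation (replicate_pmf b Q)
      (\<lambda>I. merit (Suc k) (accsvrda_step d n f R yt xt \<eta> b Q (Suc k) I (u, z, h)))
    \<le> measure_pmf.expectation (replicate_pmf b Q)
      (\<lambda>I. (merit k (u, z, h) + a * (lin y x + R x) + a * (\<delta> I \<bullet> (z - x))) + a\<^sup>2 / (4 * \<kappa>) * (norm (\<delta> I))\<^sup>2)"
    unfolding a_def y_def \<delta>_def
    by (intro expectation_mono_support fin step_valid_and_merit(2) st set_batch)
  also have "\<dots> = merit k (u, z, h) + a * (lin y x + R x)
      + a\<^sup>2 / (4 * \<kappa>) * measure_pmf.expectation (replicate_pmf b Q) (\<lambda>I. (norm (\<delta> I))\<^sup>2)"
  proof -
    have "measure_pmf.expectation (replicate_pmf b Q)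
      (\<lambda>I. 0 + a\<^sup>2 / (4 * \<kappa>) * (norm (\<delta> I))\<^sup>2) =
      0 + a\<^sup>2 / (4 * \<kappa>) * measure_pmf.expectation (replicate_pmf b Q) (\<lambda>I. (norm (\<delta> I))\<^sup>2)"
      by (rule expectation_affine[OF fin])
    then show ?thesis
      unfolding expectation_add_finite[OF fin] expectation_affine[OF fin]
      by (simp add: \<delta>_def grad_est_moments(1)[OF xt y b])
  qed
  also have "\<dots> \<le> merit k (u, z, h) + a * (lin y x + R x) + a\<^sup>2 / (4 * \<kappa>) * (Lbar / real b * gap xt y)"
    using grad_est_moments(2)[OF xt y b] \<kappa>_pos by (intro add_left_mono mult_left_mono) (auto simp: \<delta>_def)
  also have "a\<^sup>2 / (4 * \<kappa>) * (Lbar / real b * gap xt y) = a * (a / (real M + 1) * (gap xt y / (2 * \<gamma>)))"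
    using Lbar_pos b by (simp add: \<kappa>_def power2_eq_square)
  also have "\<dots> \<le> a * (1 / 2 * (gap xt y / (2 * \<gamma>)))"
    using k \<gamma> gap_nonneg[of xt y]
    by (intro mult_left_mono mult_right_mono) (auto simp: a_def field_simps)
  finally have "measure_pmf.expectation (replicate_pmf b Q)
      (\<lambda>I. merit (Suc k) (accsvrda_step d n f R yt xt \<eta> b Q (Suc k) I (u, z, h)))
    \<le> merit k (u, z, h) + a * (lin y x + R x + gap xt y / (4 * \<gamma>))"
    by (simp add: distrib_left)
  also have "\<dots> \<le> merit k (u, z, h) + a * B"
    using B[OF y] by (intro add_left_mono mult_left_mono) (auto simp: a_def)
  finally show ?thesis by (simp add: a_def)
qed

lemma expected_merit:
  assumes "k \<le> M" and B: "\<And>y. y \<in> Rd d \<Longrightarrow> lin y x + R x + gap xt y / (4 * \<gamma>) \<le> B"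
  shows "measure_pmf.expectation (state k) (merit k)
    \<le> weight_sum k * B + 1 / (2 * \<eta>) * (norm (x - yt))\<^sup>2"
  using assms(1)
proof (induction k)
  case 0
  then show ?case by (simp add: merit_def model_def weight_sum_def)
next
  case (Suc k)
  have "measure_pmf.expectation (state (Suc k)) (merit (Suc k))
      \<le> measure_pmf.expectation (state k) (\<lambda>st. (real k + 1) / 2 * B + 1 * merit k st)"
    unfolding accsvrda_state.simps
  proof (rule expectation_bind_le[OF finite_state])
    fix st assume st: "st \<in> set_pmf (state k)"
    obtain u z h where [simp]: "st = (u, z, h)" by (cases st)
    show "finite (set_pmf (replicate_pmf b Q \<bind>
        (\<lambda>I. return_pmf (accsvrda_step d n f R yt xt \<eta> b Q (Suc k) I st))))"
      by (auto intro: finite_set_replicate_pmf[OF finite_Q])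
    show "measure_pmf.expectation (replicate_pmf b Q \<bind>
        (\<lambda>I. return_pmf (accsvrda_step d n f R yt xt \<eta> b Q (Suc k) I st))) (merit (Suc k))
      \<le> (real k + 1) / 2 * B + 1 * merit k st"
      using merit_expected_step[OF _ Suc.prems B] state_valid[OF st]
      by (simp add: expectation_bind_finite finite_set_replicate_pmf[OF finite_Q] add.commute)
  qed
  also have "\<dots> = (real k + 1) / 2 * B + measure_pmf.expectation (state k) (merit k)"
    unfolding expectation_affine[OF finite_state] by simp
  also have "\<dots> \<le> weight_sum (Suc k) * B + 1 / (2 * \<eta>) * (norm (x - yt))\<^sup>2"
    using Suc by (simp add: weight_sum_Suc algebra_simps)
  finally show ?case .
qed

abbreviation "stage m \<equiv> one_stage_accsvrda d n f R yt xt \<eta> m b Q"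

lemma finite_stage: "finite (set_pmf (stage m))"
  by (simp add: one_stage_accsvrda_def finite_state)

lemma stage_in: "uz \<in> set_pmf (stage m) \<Longrightarrow> fst uz \<in> Rd d \<and> snd uz \<in> Rd d"
  using state_valid by (auto simp: one_stage_accsvrda_def valid_def)

lemma stage_bound:
  assumes m: "1 \<le> m" "m \<le> M" and B: "\<And>y. y \<in> Rd d \<Longrightarrow> lin y x + R x + gap xt y / (4 * \<gamma>) \<le> B"
  defines "K \<equiv> 2 / (\<eta> * (real m * (real m + 1)))"
  shows "measure_pmf.expectation (stage m) (\<lambda>uz. P (fst uz) + K * (norm (x - snd uz))\<^sup>2)
    \<le> B + K * (norm (x - yt))\<^sup>2"
proof -
  let ?A = "weight_sum m"
  have A: "?A > 0" using m by (simp add: weight_sum_def)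
  have K: "K = 1 / (2 * \<eta>) / ?A" by (simp add: K_def weight_sum_def field_simps)
  have "measure_pmf.expectation (stage m) (\<lambda>uz. P (fst uz) + K * (norm (x - snd uz))\<^sup>2)
      = measure_pmf.expectation (state m) (\<lambda>(u, z, h). P u + K * (norm (x - z))\<^sup>2)"
    by (simp add: one_stage_accsvrda_def case_prod_unfold)
  also have "\<dots> \<le> measure_pmf.expectation (state m) (\<lambda>st. 0 + 1 / ?A * merit m st)"
  proof (rule expectation_mono_support[OF finite_state])
    fix st assume st: "st \<in> set_pmf (state m)"
    obtain u z h where [simp]: "st = (u, z, h)" by (cases st)
    show "(\<lambda>(u, z, h). P u + K * (norm (x - z))\<^sup>2) st \<le> 0 + 1 / ?A * merit m st"
      using merit_lower[of m u z h] state_valid[OF st] A by (simp add: K field_simps)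
  qed
  also have "\<dots> = 1 / ?A * measure_pmf.expectation (state m) (merit m)"
    unfolding expectation_affine[OF finite_state] by simp
  also have "\<dots> \<le> 1 / ?A * (?A * B + 1 / (2 * \<eta>) * (norm (x - yt))\<^sup>2)"
    using A by (intro mult_left_mono expected_merit[OF m(2) B]) auto
  also have "\<dots> = B + K * (norm (x - yt))\<^sup>2" using A by (simp add: K distrib_left)
  finally show ?thesis .
qed

end


section \<open>Two ways to use a stage\<close>

context composite_problem
begin

lemma stage_locale:
  assumes "yt \<in> Rd d" "xt \<in> Rd d" "x \<in> Rd d" "b \<ge> 1" "\<gamma> > 0"
  shows "accsvrda_stage d n f L R yt xt x (step_size n L \<gamma> M b) \<gamma> b M"
  using assms by unfold_locales auto

definition "dist_weight \<gamma> M b m = 2 / (step_size n L \<gamma> M b * (real m * (real m + 1)))"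

lemma dist_weight_nonneg: "\<gamma> \<ge> 0 \<Longrightarrow> dist_weight \<gamma> M b m \<ge> 0"
  using Lbar_pos by (simp add: dist_weight_def step_size_def)

lemma stage_excess_bound:
  assumes "yt \<in> Rd d" "xt \<in> Rd d" "x \<in> Rd d" "b \<ge> 1" "\<gamma> > 0" "1 \<le> m" "m \<le> M"
    and B: "\<And>y. y \<in> Rd d \<Longrightarrow> lin y x + R x + gap xt y / (4 * \<gamma>) \<le> B"
  shows "measure_pmf.expectation (one_stage_accsvrda d n f R yt xt (step_size n L \<gamma> M b) m b Q)
      (\<lambda>uz. P (fst uz) - c + dist_weight \<gamma> M b m * (norm (x - snd uz))\<^sup>2)
    \<le> B - c + dist_weight \<gamma> M b m * (norm (x - yt))\<^sup>2"
proof -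
  interpret accsvrda_stage d n f L R yt xt x "step_size n L \<gamma> M b" \<gamma> b M
    using assms by (intro stage_locale)
  have "measure_pmf.expectation (stage m) (\<lambda>uz. P (fst uz) - c + dist_weight \<gamma> M b m * (norm (x - snd uz))\<^sup>2)
      = measure_pmf.expectation (stage m) (\<lambda>uz. - c + 1 * (P (fst uz) + dist_weight \<gamma> M b m * (norm (x - snd uz))\<^sup>2))"
    by (simp add: algebra_simps)
  also have "\<dots> = - c + measure_pmf.expectation (stage m)
      (\<lambda>uz. P (fst uz) + dist_weight \<gamma> M b m * (norm (x - snd uz))\<^sup>2)"
    unfolding expectation_affine[OF finite_stage] by simp
  finally show ?thesis
    using stage_bound[OF \<open>1 \<le> m\<close> \<open>m \<le> M\<close> B] by (simp add: dist_weight_def)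
qed

text \<open>
  At a comparison point that is close enough to the snapshot \<open>xt\<close>, the weight of the snapshot in
  the linearisation pays for the whole variance.
\<close>

lemma stage_toward:
  assumes "yt \<in> Rd d" "xt \<in> Rd d" "u \<in> Rd d" "b \<ge> 1" "\<gamma> > 0" "1 \<le> m" "m \<le> M"
    and \<tau>: "0 \<le> \<tau>" "\<tau> \<le> 1 - 1 / (2 * \<gamma>)"
  defines "x \<equiv> (1 - \<tau>) *\<^sub>R xt + \<tau> *\<^sub>R u"
  shows "measure_pmf.expectation (one_stage_accsvrda d n f R yt xt (step_size n L \<gamma> M b) m b Q)
      (\<lambda>uz. P (fst uz) - P u + dist_weight \<gamma> M b m * (norm (x - snd uz))\<^sup>2)
    \<le> (1 - \<tau>) * (P xt - P u) + dist_weight \<gamma> M b m * (norm (x - yt))\<^sup>2"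
proof -
  have \<tau>1: "\<tau> \<le> 1" using \<tau> \<open>\<gamma> > 0\<close> by (smt (verit) divide_nonneg_pos)
  have x: "x \<in> Rd d" using assms by simp
  have R: "R x \<le> (1 - \<tau>) * R xt + \<tau> * R u"
    unfolding x_def using \<tau> \<tau>1 assms by (intro convex_onD[OF R_convex]) auto
  have "lin y x + R x + gap xt y / (4 * \<gamma>) \<le> (1 - \<tau>) * P xt + \<tau> * P u" if y: "y \<in> Rd d" for y
  proof -
    have "gap xt y / (4 * \<gamma>) \<le> 2 * (F xt - lin y xt) / (4 * \<gamma>)"
      using gap_le_Bregman[OF \<open>xt \<in> Rd d\<close> y] \<open>\<gamma> > 0\<close> by (intro divide_right_mono) auto
    also have "\<dots> = 1 / (2 * \<gamma>) * (F xt - lin y xt)" using \<open>\<gamma> > 0\<close> by (simp add: field_simps)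
    also have "\<dots> \<le> (1 - \<tau>) * (F xt - lin y xt)"
      using lin_le_F[OF \<open>xt \<in> Rd d\<close> y] \<tau> by (intro mult_right_mono) auto
    finally have "gap xt y / (4 * \<gamma>) \<le> (1 - \<tau>) * (F xt - lin y xt)" .
    moreover have "\<tau> * lin y u \<le> \<tau> * F u"
      using lin_le_F[OF \<open>u \<in> Rd d\<close> y] \<tau> by (intro mult_left_mono)
    ultimately show ?thesis
      using R unfolding x_def lin_affine P_def by (simp add: algebra_simps)
  qed
  from stage_excess_bound[OF assms(1,2) x assms(4-7) this, of "P u"]
  show ?thesis by (simp add: algebra_simps)
qed

text \<open>
  At a comparison point closer to \<open>xs\<close> the variance is split through the gradients at \<open>xs\<close>. One part
  is paid by the linearisation at \<open>xs\<close>, the other is a multiple of the Bregman distance from \<open>xs\<close> to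
  the snapshot.
\<close>

lemma stage_near:
  assumes "yt \<in> Rd d" "xt \<in> Rd d" "xs \<in> Rd d" "b \<ge> 1" "\<gamma> > 0" "1 \<le> m" "m \<le> M"
    and \<tau>: "1 / \<gamma> \<le> \<tau>" "\<tau> \<le> 1"
  defines "x \<equiv> (1 - \<tau>) *\<^sub>R xt + \<tau> *\<^sub>R xs"
  shows "measure_pmf.expectation (one_stage_accsvrda d n f R yt xt (step_size n L \<gamma> M b) m b Q)
      (\<lambda>uz. P (fst uz) - P xs + dist_weight \<gamma> M b m * (norm (x - snd uz))\<^sup>2)
    \<le> (1 - \<tau>) * (P xt - P xs) + 1 / \<gamma> * (F xt - lin xs xt)
      + dist_weight \<gamma> M b m * (norm (x - yt))\<^sup>2"
proof -
  have \<tau>0: "0 \<le> \<tau>" using \<tau>(1) \<open>\<gamma> > 0\<close> by (smt (verit) divide_nonneg_pos)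
  have x: "x \<in> Rd d" using assms by simp
  have R: "R x \<le> (1 - \<tau>) * R xt + \<tau> * R xs"
    unfolding x_def using \<tau> \<tau>0 assms by (intro convex_onD[OF R_convex]) auto
  have "lin y x + R x + gap xt y / (4 * \<gamma>)
      \<le> (1 - \<tau>) * P xt + \<tau> * P xs + 1 / \<gamma> * (F xt - lin xs xt)" if y: "y \<in> Rd d" for y
  proof -
    have "gap xt y \<le> 4 * (F xt - lin xs xt) + 4 * (F xs - lin y xs)"
      using gap_triangle[of xt y xs] gap_le_Bregman[OF \<open>xt \<in> Rd d\<close> \<open>xs \<in> Rd d\<close>]
        gap_le_Bregman[OF \<open>xs \<in> Rd d\<close> y] by linarith
    then have "gap xt y / (4 * \<gamma>) \<le> (4 * (F xt - lin xs xt) + 4 * (F xs - lin y xs)) / (4 * \<gamma>)"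
      using \<open>\<gamma> > 0\<close> by (intro divide_right_mono) auto
    also have "\<dots> = 1 / \<gamma> * (F xt - lin xs xt) + 1 / \<gamma> * (F xs - lin y xs)"
      using \<open>\<gamma> > 0\<close> by (simp add: field_simps)
    also have "1 / \<gamma> * (F xs - lin y xs) \<le> \<tau> * (F xs - lin y xs)"
      using lin_le_F[OF \<open>xs \<in> Rd d\<close> y] \<tau> by (intro mult_right_mono) auto
    finally have "gap xt y / (4 * \<gamma>) \<le> 1 / \<gamma> * (F xt - lin xs xt) + \<tau> * (F xs - lin y xs)" by simp
    moreover have "(1 - \<tau>) * lin y xt \<le> (1 - \<tau>) * F xt"
      using lin_le_F[OF \<open>xt \<in> Rd d\<close> y] \<tau> by (intro mult_left_mono) auto
    ultimately show ?thesis
      using R unfolding x_def lin_affine P_def by (simp add: algebra_simps)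
  qed
  from stage_excess_bound[OF assms(1,2) x assms(4-7) this, of "P xs"]
  show ?thesis by (simp add: algebra_simps)
qed

lemma stage_finite: "finite (set_pmf (one_stage_accsvrda d n f R yt xt (step_size n L \<gamma> M b) m b Q))"
  if "yt \<in> Rd d" "xt \<in> Rd d" "b \<ge> 1" "\<gamma> > 0"
proof -
  interpret accsvrda_stage d n f L R yt xt xt "step_size n L \<gamma> M b" \<gamma> b M
    using that by (intro stage_locale)
  show ?thesis by (rule finite_stage)
qed

lemma stage_closed:
  assumes "yt \<in> Rd d" "xt \<in> Rd d" "b \<ge> 1" "\<gamma> > 0"
    "uz \<in> set_pmf (one_stage_accsvrda d n f R yt xt (step_size n L \<gamma> M b) m b Q)"
  shows "fst uz \<in> Rd d" "snd uz \<in> Rd d"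
proof -
  interpret accsvrda_stage d n f L R yt xt xt "step_size n L \<gamma> M b" \<gamma> b M
    using assms by (intro stage_locale)
  show "fst uz \<in> Rd d" "snd uz \<in> Rd d" using stage_in[OF assms(5)] by auto
qed

end


section \<open>The outer loop\<close>

locale das_loop = composite_problem +
  fixes xs :: rvec and \<gamma> :: real and b M :: nat
  assumes xs: "xs \<in> Rd d" and xs_min: "\<And>x. x \<in> Rd d \<Longrightarrow> P xs \<le> P x"
    and \<gamma>: "\<gamma> \<ge> 3" and b: "b \<ge> 1" and M: "M \<ge> 1"
begin

abbreviation "\<theta> \<equiv> theta_outer \<gamma>"
abbreviation "K \<equiv> dist_weight \<gamma> M b M"
abbreviation "stg y x \<equiv> one_stage_accsvrda d n f R y x (step_size n L \<gamma> M b) M b Q"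

lemma \<gamma>_pos: "\<gamma> > 0"
  using \<gamma> by simp

lemma K_nonneg: "K \<ge> 0"
  using \<gamma> by (simp add: dist_weight_nonneg)

lemma contraction_ge: "2 / 3 \<le> 1 - 1 / \<gamma>"
  using \<gamma> by (simp add: field_simps)

lemma \<theta>_lower: "(real s + 2) / 3 \<le> \<theta> s"
proof -
  have "(real s + 2) / 3 = 2 / 3 * ((real s + 2) / 2)" by simp
  also have "\<dots> \<le> (1 - 1 / \<gamma>) * ((real s + 2) / 2)"
    by (intro mult_right_mono contraction_ge) auto
  finally show ?thesis by (simp only: theta_outer_def)
qed

lemma \<theta>_recursion: "(\<theta> (Suc s))\<^sup>2 - \<theta> (Suc s) \<le> (\<theta> s)\<^sup>2"
proof -
  define c where "c = 1 - 1 / \<gamma>"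
  have c: "0 \<le> c" "c \<le> 1" using \<gamma> by (auto simp: c_def)
  have "(\<theta> (Suc s))\<^sup>2 - \<theta> (Suc s) - (\<theta> s)\<^sup>2 = c * (c * (2 * real s + 5) - 2 * (real s + 3)) / 4"
    unfolding theta_outer_def c_def[symmetric] by (simp add: power2_eq_square field_simps)
  also have "\<dots> \<le> 0"
  proof -
    have "c * (2 * real s + 5) \<le> 2 * real s + 5" using c by (intro mult_left_le_one_le) auto
    also have "\<dots> \<le> 2 * (real s + 3)" by simp
    finally have "c * (2 * real s + 5) - 2 * (real s + 3) \<le> 0" by simp
    then show ?thesis using c by (intro divide_nonpos_pos mult_nonneg_nonpos) auto
  qed
  finally show ?thesis by simp
qed

text \<open>
  The vector that the extrapolation transports from stage to stage. It is \<open>\<theta> s\<close> times the difference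
  between the comparison point of stage \<open>s\<close> and the vector \<open>z\<close> after it, and also \<open>\<theta> (Suc s)\<close> times
  the difference between the comparison point and the starting point of the next stage.
\<close>

definition "lag s xprev z = (\<theta> s - 1) *\<^sub>R xprev + xs - \<theta> s *\<^sub>R z"

definition "start s = (\<lambda>(x, xprev, z). x + ((\<theta> s - 1) / \<theta> (Suc s)) *\<^sub>R (x - xprev)
               + (\<theta> s / \<theta> (Suc s)) *\<^sub>R (z - x))"

text \<open>
  The excess is weighted with the square of \<open>\<theta>\<close>, since scaling the comparison point to the lag
  multiplies the stage inequality by that square.
\<close>

definition "energy s = (\<lambda>(x, xprev, z). (\<theta> s)\<^sup>2 * (P x - P xs) + K * (norm (lag s xprev z))\<^sup>2)"

definition "target s x = (1 - 1 / \<theta> s) *\<^sub>R x + (1 / \<theta> s) *\<^sub>R xs"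

lemma \<theta>_pos: "\<theta> s > 0"
  using \<theta>_lower[of s] by (smt (verit) divide_pos_pos of_nat_0_le_iff)

lemma target_lag: "\<theta> s *\<^sub>R (target s x - z) = lag s x z"
  using \<theta>_pos[of s]
  by (simp add: target_def lag_def scaleR_diff_right scaleR_add_right diff_divide_distrib algebra_simps)

lemma target_start: "\<theta> (Suc s) *\<^sub>R (target (Suc s) x - start s (x, xprev, z)) = lag s xprev z"
proof -
  have "\<theta> (Suc s) * (1 - 1 / \<theta> (Suc s)) = \<theta> (Suc s) - 1"
    using \<theta>_pos[of "Suc s"] by (simp add: right_diff_distrib)
  then show ?thesis
    using \<theta>_pos[of "Suc s"]
    by (simp add: target_def start_def lag_def scaleR_diff_right scaleR_add_right)
      (simp add: algebra_simps)
qed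

lemma norm_lag:
  "(norm (lag s x z))\<^sup>2 = (\<theta> s)\<^sup>2 * (norm (target s x - z))\<^sup>2"
  "(norm (lag s xprev z))\<^sup>2 = (\<theta> (Suc s))\<^sup>2 * (norm (target (Suc s) x - start s (x, xprev, z)))\<^sup>2"
  unfolding target_lag[symmetric, of s x z] target_start[symmetric, of s xprev z x]
  by (simp_all add: power_mult_distrib)

lemma start_in: "x \<in> Rd d \<Longrightarrow> xprev \<in> Rd d \<Longrightarrow> z \<in> Rd d \<Longrightarrow> start s (x, xprev, z) \<in> Rd d"
  by (simp add: start_def)

lemma energy_scale:
  assumes "x \<in> Rd d" "y \<in> Rd d"
  shows "measure_pmf.expectation (stg y x) (\<lambda>uz. energy s (fst uz, x, snd uz))
    = (\<theta> s)\<^sup>2 * measure_pmf.expectation (stg y x)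
        (\<lambda>uz. P (fst uz) - P xs + K * (norm (target s x - snd uz))\<^sup>2)"
  unfolding energy_def prod.case norm_lag
  using expectation_affine[OF stage_finite[OF assms(2,1) b \<gamma>_pos, of M M], of 0 "(\<theta> s)\<^sup>2"
      "\<lambda>uz. P (fst uz) - P xs + K * (norm (target s x - snd uz))\<^sup>2"]
  by (simp add: algebra_simps)

text \<open>
  From the second stage on \<open>\<theta>\<close> is at least \<open>4 / 3\<close>, which keeps the comparison point far enough from
  the minimiser for the first way of using a stage.
\<close>

lemma energy_step:
  assumes "x \<in> Rd d" "xprev \<in> Rd d" "z \<in> Rd d" and s: "s \<ge> 1"
  shows "measure_pmf.expectation (stg (start s (x, xprev, z)) x)
      (\<lambda>uz. energy (Suc s) (fst uz, x, snd uz)) \<le> energy s (x, xprev, z)"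
proof -
  let ?\<tau> = "1 / \<theta> (Suc s)"
  have inv: "1 / \<gamma> \<le> 1 / 3" using \<gamma> by (simp add: field_simps)
  have "4 / 3 \<le> \<theta> (Suc s)" "0 < \<theta> (Suc s)"
    using \<theta>_lower[of "Suc s"] s \<theta>_pos by auto
  then have "?\<tau> \<le> 3 / 4" by (simp add: field_simps)
  then have \<tau>: "0 \<le> ?\<tau>" "?\<tau> \<le> 1 - 1 / (2 * \<gamma>)"
    using \<theta>_pos[of "Suc s"] inv by auto
  have "measure_pmf.expectation (stg (start s (x, xprev, z)) x) (\<lambda>uz. energy (Suc s) (fst uz, x, snd uz))
      \<le> (\<theta> (Suc s))\<^sup>2 * ((1 - ?\<tau>) * (P x - P xs)
          + K * (norm (target (Suc s) x - start s (x, xprev, z)))\<^sup>2)"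
    unfolding energy_scale[OF assms(1) start_in[OF assms(1-3)]] target_def
    using assms xs b \<gamma>_pos M \<tau> by (intro mult_left_mono stage_toward start_in) auto
  also have "\<dots> = (\<theta> (Suc s))\<^sup>2 * (1 - ?\<tau>) * (P x - P xs) + K * (norm (lag s xprev z))\<^sup>2"
    unfolding norm_lag(2)[of s xprev z x] by (simp only: distrib_left ac_simps)
  also have "(\<theta> (Suc s))\<^sup>2 * (1 - ?\<tau>) = (\<theta> (Suc s))\<^sup>2 - \<theta> (Suc s)"
    using \<theta>_pos[of "Suc s"] by (simp add: field_simps power2_eq_square)
  also have "\<dots> * (P x - P xs) \<le> (\<theta> s)\<^sup>2 * (P x - P xs)"
    using xs_min[OF assms(1)] by (intro mult_right_mono \<theta>_recursion) auto
  finally show ?thesis by (simp add: energy_def)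
qed

lemma \<theta>_1: "1 \<le> \<theta> 1" "\<theta> 1 \<le> 3 / 2"
  using \<theta>_lower[of 1] \<gamma> by (simp_all add: theta_outer_def)

lemma lag_0: "lag 0 z z = xs - z"
  by (simp add: lag_def algebra_simps)

text \<open>
  In the first stage the comparison point can be too close to the minimiser for the snapshot to pay
  for the variance. The remaining part costs a constant factor only, once.
\<close>

lemma first_energy:
  assumes x0: "x0 \<in> Rd d" and z0: "z0 \<in> Rd d"
  shows "measure_pmf.expectation (stg (start 0 (x0, z0, z0)) x0) (\<lambda>uz. energy 1 (fst uz, x0, snd uz))
    \<le> 3 * (P x0 - P xs) + K * (norm (xs - z0))\<^sup>2"
proof -
  let ?\<tau> = "1 / \<theta> 1"
  have inv: "1 / \<gamma> \<le> 1 / 3" using \<gamma> by (simp add: field_simps)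
  have \<tau>: "2 / 3 \<le> ?\<tau>" "?\<tau> \<le> 1" using \<theta>_1 by (simp_all add: field_simps)
  have "measure_pmf.expectation (stg (start 0 (x0, z0, z0)) x0) (\<lambda>uz. energy 1 (fst uz, x0, snd uz))
      \<le> (\<theta> 1)\<^sup>2 * ((1 - ?\<tau>) * (P x0 - P xs) + 1 / \<gamma> * (F x0 - lin xs x0)
          + K * (norm (target 1 x0 - start 0 (x0, z0, z0)))\<^sup>2)"
    unfolding energy_scale[OF x0 start_in[OF x0 z0 z0]] target_def
    by (intro mult_left_mono stage_near start_in x0 z0 xs b \<gamma>_pos M order.refl \<tau>
        order.trans[OF inv]) (use \<tau> in auto)
  also have "\<dots> = (\<theta> 1)\<^sup>2 * ((1 - ?\<tau>) * (P x0 - P xs) + 1 / \<gamma> * (F x0 - lin xs x0))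
      + K * (norm (xs - z0))\<^sup>2"
    using norm_lag(2)[of 0 z0 z0 x0] by (simp add: lag_0 distrib_left)
  also have "(\<theta> 1)\<^sup>2 * ((1 - ?\<tau>) * (P x0 - P xs) + 1 / \<gamma> * (F x0 - lin xs x0)) \<le> 3 * (P x0 - P xs)"
  proof -
    have D: "0 \<le> F x0 - lin xs x0" "F x0 - lin xs x0 \<le> P x0 - P xs"
      using lin_le_F[OF x0 xs] Bregman_at_minimizer[OF xs xs_min x0] by auto
    have "(1 - ?\<tau>) * (P x0 - P xs) \<le> 1 / 3 * (P x0 - P xs)"
      using \<tau> D by (intro mult_right_mono) auto
    moreover have "1 / \<gamma> * (F x0 - lin xs x0) \<le> 1 / 3 * (P x0 - P xs)"
      using D inv \<gamma>_pos by (intro mult_mono) auto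
    ultimately have *: "(1 - ?\<tau>) * (P x0 - P xs) + 1 / \<gamma> * (F x0 - lin xs x0) \<le> 2 / 3 * (P x0 - P xs)"
      by simp
    have "(\<theta> 1)\<^sup>2 \<le> (3 / 2)\<^sup>2" using \<theta>_1 by (intro power_mono) auto
    then have "(\<theta> 1)\<^sup>2 * ((1 - ?\<tau>) * (P x0 - P xs) + 1 / \<gamma> * (F x0 - lin xs x0))
        \<le> (3 / 2)\<^sup>2 * (2 / 3 * (P x0 - P xs))"
      using * \<tau> D \<gamma>_pos by (intro mult_mono) auto
    also have "\<dots> = 3 / 2 * (P x0 - P xs)" by (simp add: power2_eq_square)
    also have "\<dots> \<le> 3 * (P x0 - P xs)" using D by (intro mult_right_mono) auto
    finally show ?thesis .
  qed
  finally show ?thesis by simp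
qed

text \<open>
  If the loop starts with equal vectors, then the first stage can be compared with the minimiser
  itself. This avoids the objective value at the starting point, which the regulariser can make
  arbitrarily large.
\<close>

lemma first_energy_equal_start:
  assumes x0: "x0 \<in> Rd d"
  shows "measure_pmf.expectation (stg (start 0 (x0, x0, x0)) x0) (\<lambda>uz. energy 1 (fst uz, x0, snd uz))
    \<le> 5 * (F x0 - lin xs x0 + K * (norm (xs - x0))\<^sup>2)"
proof -
  let ?h = "\<lambda>uz. P (fst uz) - P xs + K * (norm (xs - snd uz))\<^sup>2"
  let ?D = "F x0 - lin xs x0" and ?r = "K * (norm (xs - x0))\<^sup>2"
  have inv: "1 / \<gamma> \<le> 1 / 3" using \<gamma> by (simp add: field_simps)
  have start: "start 0 (x0, x0, x0) = x0" by (simp add: start_def)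
  note fin = stage_finite[OF x0 x0 b \<gamma>_pos, of M M]
  have D: "0 \<le> ?D" using lin_le_F[OF x0 xs] by simp
  have r: "0 \<le> ?r" using K_nonneg by simp
  have near: "measure_pmf.expectation (stg x0 x0) ?h \<le> 1 / \<gamma> * ?D + ?r"
    using stage_near[OF x0 x0 xs b \<gamma>_pos M order.refl, of 1] inv by simp
  have "measure_pmf.expectation (stg x0 x0) (\<lambda>uz. energy 1 (fst uz, x0, snd uz))
      \<le> measure_pmf.expectation (stg x0 x0) (\<lambda>uz. ?r / 2 + 9 / 2 * ?h uz)"
  proof (rule expectation_mono_support[OF fin])
    fix uz assume uz: "uz \<in> set_pmf (stg x0 x0)"
    have u: "P xs \<le> P (fst uz)" by (rule xs_min[OF stage_closed(1)[OF x0 x0 b \<gamma>_pos uz]])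
    let ?p = "xs - x0" and ?q = "xs - snd uz" and ?t = "\<theta> 1"
    have sq: "(?t - 1)\<^sup>2 \<le> (1 / 2)\<^sup>2" "?t\<^sup>2 \<le> (3 / 2)\<^sup>2"
      using \<theta>_1 by (auto intro!: power_mono)
    have "lag 1 x0 (snd uz) = ?t *\<^sub>R ?q - (?t - 1) *\<^sub>R ?p" by (simp add: lag_def algebra_simps)
    then have "norm (lag 1 x0 (snd uz)) \<le> ?t * norm ?q + (?t - 1) * norm ?p"
      using norm_triangle_ineq4[of "?t *\<^sub>R ?q" "(?t - 1) *\<^sub>R ?p"] \<theta>_1 by simp
    then have "(norm (lag 1 x0 (snd uz)))\<^sup>2 \<le> (?t * norm ?q + (?t - 1) * norm ?p)\<^sup>2"
      by (rule power_mono) simp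
    also have "\<dots> \<le> 2 * (?t * norm ?q)\<^sup>2 + 2 * ((?t - 1) * norm ?p)\<^sup>2"
      using sum_squares_bound[of "?t * norm ?q" "(?t - 1) * norm ?p"] by (simp add: power2_sum)
    also have "\<dots> = 2 * (?t\<^sup>2 * (norm ?q)\<^sup>2) + 2 * ((?t - 1)\<^sup>2 * (norm ?p)\<^sup>2)"
      by (simp add: power_mult_distrib)
    also have "\<dots> \<le> 2 * ((3 / 2)\<^sup>2 * (norm ?q)\<^sup>2) + 2 * ((1 / 2)\<^sup>2 * (norm ?p)\<^sup>2)"
      by (intro add_mono mult_left_mono mult_right_mono sq) auto
    finally have "(norm (lag 1 x0 (snd uz)))\<^sup>2 \<le> 9 / 2 * (norm ?q)\<^sup>2 + 1 / 2 * (norm ?p)\<^sup>2"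
      by (simp add: power2_eq_square)
    then have "K * (norm (lag 1 x0 (snd uz)))\<^sup>2 \<le> K * (9 / 2 * (norm ?q)\<^sup>2 + 1 / 2 * (norm ?p)\<^sup>2)"
      using K_nonneg by (rule mult_left_mono)
    moreover have "?t\<^sup>2 * (P (fst uz) - P xs) \<le> 9 / 2 * (P (fst uz) - P xs)"
      using sq(2) u by (intro mult_right_mono) (auto simp: power2_eq_square)
    ultimately show "energy 1 (fst uz, x0, snd uz) \<le> ?r / 2 + 9 / 2 * ?h uz"
      by (simp add: energy_def algebra_simps)
  qed
  also have "\<dots> = ?r / 2 + 9 / 2 * measure_pmf.expectation (stg x0 x0) ?h"
    by (rule expectation_affine[OF fin])
  also have "\<dots> \<le> ?r / 2 + 9 / 2 * (1 / 3 * ?D + ?r)"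
  proof -
    have "1 / \<gamma> * ?D \<le> 1 / 3 * ?D" using inv D by (rule mult_right_mono)
    then have "measure_pmf.expectation (stg x0 x0) ?h \<le> 1 / 3 * ?D + ?r" using near by linarith
    then show ?thesis by (intro add_left_mono mult_left_mono) auto
  qed
  also have "\<dots> \<le> 5 * (?D + ?r)"
  proof -
    have "v / 2 + 9 / 2 * (1 / 3 * w + v) \<le> 5 * (w + v)" if "0 \<le> w" "0 \<le> v" for v w :: real
      using that by (simp add: field_simps)
    then show ?thesis using D r .
  qed
  finally show ?thesis by (simp only: start)
qed

abbreviation "loop x0 z0 s \<equiv> dasvrda_ns_state d n f R x0 z0 \<gamma> L M b s"

lemma loop_Suc: "loop x0 z0 (Suc s) = loop x0 z0 s \<bind>
    (\<lambda>st. stg (start s st) (fst st) \<bind> (\<lambda>uz. return_pmf (fst uz, fst st, snd uz)))"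
  by (simp add: start_def case_prod_unfold Let_def)

lemma loop_closed:
  assumes "x0 \<in> Rd d" "z0 \<in> Rd d"
  shows "finite (set_pmf (loop x0 z0 s)) \<and>
    (\<forall>st\<in>set_pmf (loop x0 z0 s). fst st \<in> Rd d \<and> fst (snd st) \<in> Rd d \<and> snd (snd st) \<in> Rd d)"
proof (induction s)
  case 0
  then show ?case using assms by simp
next
  case (Suc s)
  have fin: "finite (set_pmf (stg (start s st) (fst st)))"
    and cl: "\<And>uz. uz \<in> set_pmf (stg (start s st) (fst st)) \<Longrightarrow> fst uz \<in> Rd d \<and> snd uz \<in> Rd d"
    if "st \<in> set_pmf (loop x0 z0 s)" for st
  proof -
    obtain x xp z where st: "st = (x, xp, z)" by (cases st)
    with Suc that have *: "x \<in> Rd d" "xp \<in> Rd d" "z \<in> Rd d" by force+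
    show "finite (set_pmf (stg (start s st) (fst st)))"
      using * by (auto simp: st intro!: stage_finite start_in b \<gamma>_pos)
    show "fst uz \<in> Rd d \<and> snd uz \<in> Rd d" if "uz \<in> set_pmf (stg (start s st) (fst st))" for uz
      using stage_closed[OF start_in[OF *] *(1) b \<gamma>_pos] that by (auto simp: st)
  qed
  show ?case
    unfolding loop_Suc using Suc fin cl by (auto simp del: dasvrda_ns_state.simps)
qed

lemma loop_decay:
  assumes x0: "x0 \<in> Rd d" and z0: "z0 \<in> Rd d"
    and W: "measure_pmf.expectation (stg (start 0 (x0, z0, z0)) x0)
      (\<lambda>uz. energy 1 (fst uz, x0, snd uz)) \<le> W"
  shows "measure_pmf.expectation (loop x0 z0 (Suc s)) (energy (Suc s)) \<le> W"
proof (induction s)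
  case 0
  have "measure_pmf.expectation (loop x0 z0 (Suc 0)) (energy (Suc 0))
      = measure_pmf.expectation (stg (start 0 (x0, z0, z0)) x0) (\<lambda>uz. energy 1 (fst uz, x0, snd uz))"
    unfolding loop_Suc dasvrda_ns_state.simps(1) bind_return_pmf fst_conv map_pmf_def[symmetric] by simp
  then show ?case using W by simp
next
  case (Suc s)
  note cl = loop_closed[OF x0 z0, of "Suc s"]
  have "measure_pmf.expectation (loop x0 z0 (Suc (Suc s))) (energy (Suc (Suc s)))
      \<le> measure_pmf.expectation (loop x0 z0 (Suc s)) (energy (Suc s))"
    unfolding loop_Suc[of x0 z0 "Suc s"]
  proof (rule expectation_bind_le)
    show "finite (set_pmf (loop x0 z0 (Suc s)))" using cl by simp
    fix st assume "st \<in> set_pmf (loop x0 z0 (Suc s))"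
    moreover obtain x xp z where st: "st = (x, xp, z)" by (cases st)
    ultimately have *: "x \<in> Rd d" "xp \<in> Rd d" "z \<in> Rd d" using cl by force+
    show "finite (set_pmf (stg (start (Suc s) st) (fst st) \<bind>
        (\<lambda>uz. return_pmf (fst uz, fst st, snd uz))))"
      using stage_finite[OF start_in[OF *] *(1) b \<gamma>_pos] by (simp add: st)
    show "measure_pmf.expectation (stg (start (Suc s) st) (fst st) \<bind>
        (\<lambda>uz. return_pmf (fst uz, fst st, snd uz))) (energy (Suc (Suc s))) \<le> energy (Suc s) st"
      unfolding map_pmf_def[symmetric] using energy_step[OF *, of "Suc s"] by (simp add: st)
  qed
  with Suc show ?case by linarith
qed

lemma loop_rate:
  assumes x0: "x0 \<in> Rd d" and z0: "z0 \<in> Rd d" and S: "S \<ge> 1"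
    and W: "measure_pmf.expectation (stg (start 0 (x0, z0, z0)) x0)
      (\<lambda>uz. energy 1 (fst uz, x0, snd uz)) \<le> W"
  shows "measure_pmf.expectation (dasvrda_ns d n f R x0 z0 \<gamma> L M b S) (\<lambda>x. P x - P xs)
    \<le> 9 / (real S)\<^sup>2 * W"
proof -
  note cl = loop_closed[OF x0 z0, of S]
  have "measure_pmf.expectation (dasvrda_ns d n f R x0 z0 \<gamma> L M b S) (\<lambda>x. P x - P xs)
      = measure_pmf.expectation (loop x0 z0 S) (\<lambda>st. P (fst st) - P xs)"
    by (simp add: dasvrda_ns_def case_prod_unfold)
  also have "\<dots> \<le> measure_pmf.expectation (loop x0 z0 S) (\<lambda>st. 0 + 9 / (real S)\<^sup>2 * energy S st)"
  proof (rule expectation_mono_support)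
    show "finite (set_pmf (loop x0 z0 S))" using cl by simp
    fix st assume "st \<in> set_pmf (loop x0 z0 S)"
    moreover obtain x xp z where st: "st = (x, xp, z)" by (cases st)
    ultimately have "x \<in> Rd d" using cl by force
    then have ex: "0 \<le> P x - P xs" using xs_min by simp
    have "real S / 3 \<le> \<theta> S" using \<theta>_lower[of S] by simp
    then have "(real S / 3)\<^sup>2 \<le> (\<theta> S)\<^sup>2" by (rule power_mono) simp
    then have "(real S / 3)\<^sup>2 * (P x - P xs) \<le> (\<theta> S)\<^sup>2 * (P x - P xs)"
      using ex by (rule mult_right_mono)
    also have "\<dots> \<le> energy S st" using K_nonneg by (simp add: st energy_def)
    finally show "P (fst st) - P xs \<le> 0 + 9 / (real S)\<^sup>2 * energy S st"
      using S by (simp add: st field_simps power2_eq_square)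
  qed
  also have "\<dots> = 9 / (real S)\<^sup>2 * measure_pmf.expectation (loop x0 z0 S) (energy S)"
    using cl by (subst expectation_affine) auto
  also have "\<dots> \<le> 9 / (real S)\<^sup>2 * W"
    using loop_decay[OF x0 z0 W, of "S - 1"] S by (intro mult_left_mono) auto
  finally show ?thesis .
qed

end


section \<open>The lengths of the warm-start stages\<close>

lemma nat_ceiling_bounds:
  assumes "x \<ge> (0::real)"
  shows "x \<le> real (nat \<lceil>x\<rceil>)" "real (nat \<lceil>x\<rceil>) < x + 1"
  using assms by (simp_all add: real_nat_ceiling_ge) linarith

lemma sqrt_ge_17:
  assumes "\<gamma> \<ge> (3::real)"
  shows "17 / 10 \<le> sqrt \<gamma>"
  using assms by (intro real_le_rsqrt) (simp add: power2_eq_square)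

lemma sqrt_consecutive_le:
  assumes "s \<ge> (0::real)"
  shows "sqrt ((s + 1) * s) \<le> s + 1 / 2"
  using assms by (intro real_le_lsqrt) (auto simp: power2_eq_square algebra_simps)

text \<open>
  Rounding adds at most one per stage. Shifting the lengths by 3 absorbs it, because
  \<open>1 / 2 + (1 + 3) / sqrt \<gamma> \<le> 3\<close> for \<open>\<gamma> \<ge> 3\<close>.
\<close>

lemma warm_m_growth:
  fixes m0 u :: nat
  assumes \<gamma>: "\<gamma> \<ge> 3"
  defines "s \<equiv> real (warm_m \<gamma> m0 u)" and "s' \<equiv> real (warm_m \<gamma> m0 (Suc u))"
  shows "\<gamma> * (s * (s + 1)) \<le> s' * (s' + 1)" "s \<le> s'" "s' + 3 \<le> sqrt \<gamma> * (s + 3)"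
proof -
  let ?q = "sqrt (\<gamma> * (s + 1) * s)"
  have s: "s \<ge> 0" and s'0: "s' \<ge> 0" unfolding s_def s'_def by (rule of_nat_0_le_iff)+
  have q: "?q \<ge> 0" using \<gamma> s by simp
  have s': "?q \<le> s'" "s' < ?q + 1"
    using nat_ceiling_bounds[OF q] by (simp_all add: s'_def s_def)
  have "?q\<^sup>2 \<le> s'\<^sup>2" using s'(1) q by (rule power_mono)
  then have sq: "\<gamma> * (s + 1) * s \<le> s'\<^sup>2" using \<gamma> s by simp
  then show "\<gamma> * (s * (s + 1)) \<le> s' * (s' + 1)"
    using s'0 by (simp add: power2_eq_square algebra_simps)
  have "1 * (s * s) \<le> \<gamma> * ((s + 1) * s)" using \<gamma> s by (intro mult_mono) auto
  then have "s\<^sup>2 \<le> \<gamma> * (s + 1) * s" by (simp only: mult_1 mult.assoc power2_eq_square)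
  from power2_le_imp_le[OF order.trans[OF this sq] s'0] show "s \<le> s'" .
  have "?q = sqrt \<gamma> * sqrt ((s + 1) * s)" by (simp add: real_sqrt_mult mult.assoc)
  also have "\<dots> \<le> sqrt \<gamma> * (s + 1 / 2)"
    using \<gamma> by (intro mult_left_mono sqrt_consecutive_le s) auto
  finally have "s' + 3 \<le> sqrt \<gamma> * (s + 1 / 2) + 4" using s' by simp
  also have "\<dots> \<le> sqrt \<gamma> * (s + 3)" using sqrt_ge_17[OF \<gamma>] by (simp add: algebra_simps)
  finally show "s' + 3 \<le> sqrt \<gamma> * (s + 3)" .
qed

lemma warm_m_mono: "\<gamma> \<ge> 3 \<Longrightarrow> u \<le> v \<Longrightarrow> warm_m \<gamma> m0 u \<le> warm_m \<gamma> m0 v"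
proof (induction v)
  case (Suc v)
  then show ?case
    using warm_m_growth(2)[of \<gamma> m0 v] by (cases "u = Suc v") (auto simp del: warm_m.simps)
qed simp

lemma warm_m_le_power:
  assumes \<gamma>: "\<gamma> \<ge> 3"
  shows "real (warm_m \<gamma> m0 u) + 3 \<le> sqrt \<gamma> ^ u * (real m0 + 3)"
proof (induction u)
  case (Suc u)
  have "real (warm_m \<gamma> m0 (Suc u)) + 3 \<le> sqrt \<gamma> * (real (warm_m \<gamma> m0 u) + 3)"
    by (rule warm_m_growth(3)[OF \<gamma>])
  also have "\<dots> \<le> sqrt \<gamma> * (sqrt \<gamma> ^ u * (real m0 + 3))"
    using \<gamma> by (intro mult_left_mono Suc) auto
  finally show ?case by (simp only: power_Suc mult.assoc)
qed simp

lemma warm_m_final_bounds: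
  fixes m0 U :: nat
  assumes \<gamma>: "\<gamma> \<ge> 3"
  defines "s \<equiv> real (warm_m \<gamma> m0 U)" and "M \<equiv> real (warm_m_final \<gamma> m0 U)"
  shows "s * (s + 1) \<le> M * (M + 1)" "s \<le> M" "M + 1 \<le> 3 / 2 * (s + 3)"
proof -
  let ?c = "1 - 1 / \<gamma>" and ?q = "sqrt ((s + 1) * s)"
  have s: "s \<ge> 0" and M0: "M \<ge> 0" unfolding s_def M_def by (rule of_nat_0_le_iff)+
  have c: "2 / 3 \<le> ?c" "?c \<le> 1" using \<gamma> by (auto simp: field_simps)
  have q: "?q \<ge> 0" using s by simp
  have lo: "?q \<le> ?q / ?c" using c q by (simp add: pos_le_divide_eq mult_left_le)
  have hi: "?q / ?c \<le> ?q / (2 / 3)" using c q by (intro divide_left_mono) auto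
  have M: "?q / ?c \<le> M" "M < ?q / ?c + 1"
    using nat_ceiling_bounds[OF order.trans[OF q lo]] by (simp_all add: M_def s_def warm_m_final_def)
  have "?q\<^sup>2 \<le> M\<^sup>2" using M lo q by (intro power_mono) auto
  then have sq: "(s + 1) * s \<le> M\<^sup>2" using s by simp
  then show "s * (s + 1) \<le> M * (M + 1)"
    using M0 by (simp add: power2_eq_square algebra_simps)
  have "s\<^sup>2 \<le> (s + 1) * s" using s by (simp add: power2_eq_square distrib_right)
  from power2_le_imp_le[OF order.trans[OF this sq] M0] show "s \<le> M" .
  show "M + 1 \<le> 3 / 2 * (s + 3)"
    using M(2) hi sqrt_consecutive_le[OF s] by simp
qed


section \<open>Warm start\<close>

context das_loop
begin

abbreviation "warm x0 m0 u \<equiv> warm_state d n f R x0 \<gamma> L m0 (step_size n L \<gamma> M b) b u"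

lemma warm_Suc: "warm x0 m0 (Suc u) = warm x0 m0 u \<bind> (\<lambda>xz. one_stage_accsvrda d n f R (snd xz) (fst xz)
    (step_size n L \<gamma> M b) (warm_m \<gamma> m0 (Suc u)) b Q)"
  by (simp add: case_prod_unfold del: warm_m.simps)

lemma warm_closed:
  assumes "x0 \<in> Rd d"
  shows "finite (set_pmf (warm x0 m0 u)) \<and> (\<forall>xz\<in>set_pmf (warm x0 m0 u). fst xz \<in> Rd d \<and> snd xz \<in> Rd d)"
proof (induction u)
  case 0
  then show ?case using assms by simp
next
  case (Suc u)
  then show ?case
    unfolding warm_Suc
    by (auto simp del: warm_state.simps warm_m.simps
        intro!: stage_finite[OF _ _ b \<gamma>_pos] dest: stage_closed[OF _ _ b \<gamma>_pos, rotated 2])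
qed

lemma dist_weight_antimono:
  assumes m: "m \<ge> 1" and c: "c > 0" and le: "c * (real m * (real m + 1)) \<le> real m' * (real m' + 1)"
  shows "dist_weight \<gamma> M b m' \<le> 1 / c * dist_weight \<gamma> M b m"
proof -
  have \<eta>: "step_size n L \<gamma> M b > 0"
    using Lbar_pos \<gamma> by (auto simp: step_size_def intro!: mult_pos_pos add_pos_nonneg)
  have "0 < c * (real m * (real m + 1))" using m c by simp
  then have "0 < step_size n L \<gamma> M b * (c * (real m * (real m + 1)))"
    using \<eta> by (simp only: mult_pos_pos)
  then have "dist_weight \<gamma> M b m' \<le> 2 / (step_size n L \<gamma> M b * (c * (real m * (real m + 1))))"
    unfolding dist_weight_def using le \<eta> by (intro frac_le mult_left_mono) auto
  also have "\<dots> = 1 / c * dist_weight \<gamma> M b m" by (simp add: dist_weight_def)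
  finally show ?thesis .
qed

text \<open>
  Compared with the minimiser itself, a stage multiplies the excess by \<open>1 / \<gamma>\<close>, and the growing
  stage length does the same to the weight of the distance term. The excess enters only through the
  Bregman distance, which is why the first stage forgets the value of the regulariser.
\<close>

lemma warm_stage:
  assumes "x \<in> Rd d" "z \<in> Rd d" and m: "m \<ge> 1" "m' \<ge> 1" "m' \<le> M"
    and le: "\<gamma> * (real m * (real m + 1)) \<le> real m' * (real m' + 1)"
  shows "measure_pmf.expectation (one_stage_accsvrda d n f R z x (step_size n L \<gamma> M b) m' b Q)
      (\<lambda>uz. P (fst uz) - P xs + dist_weight \<gamma> M b m' * (norm (xs - snd uz))\<^sup>2)
    \<le> 1 / \<gamma> * (F x - lin xs x + dist_weight \<gamma> M b m * (norm (xs - z))\<^sup>2)"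
proof -
  have "1 / \<gamma> \<le> 1" using \<gamma> by simp
  from stage_near[OF assms(2,1) xs b \<gamma>_pos m(2,3) this order.refl]
  have "measure_pmf.expectation (one_stage_accsvrda d n f R z x (step_size n L \<gamma> M b) m' b Q)
      (\<lambda>uz. P (fst uz) - P xs + dist_weight \<gamma> M b m' * (norm (xs - snd uz))\<^sup>2)
    \<le> 1 / \<gamma> * (F x - lin xs x) + dist_weight \<gamma> M b m' * (norm (xs - z))\<^sup>2" by simp
  also have "\<dots> \<le> 1 / \<gamma> * (F x - lin xs x) + (1 / \<gamma> * dist_weight \<gamma> M b m) * (norm (xs - z))\<^sup>2"
    by (intro add_left_mono mult_right_mono dist_weight_antimono m \<gamma>_pos le) auto
  finally show ?thesis by (simp only: distrib_left mult.assoc)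
qed

lemma warm_decay:
  assumes x0: "x0 \<in> Rd d" and m0: "m0 \<ge> 1" and "warm_m \<gamma> m0 (Suc u) \<le> M"
  shows "measure_pmf.expectation (warm x0 m0 (Suc u))
      (\<lambda>uz. P (fst uz) - P xs + dist_weight \<gamma> M b (warm_m \<gamma> m0 (Suc u)) * (norm (xs - snd uz))\<^sup>2)
    \<le> (1 / \<gamma>) ^ Suc u * (F x0 - lin xs x0 + dist_weight \<gamma> M b m0 * (norm (xs - x0))\<^sup>2)"
  using assms(3)
proof (induction u)
  case 0
  have "1 \<le> warm_m \<gamma> m0 (Suc 0)" using warm_m_mono[OF \<gamma>, of 0 "Suc 0" m0] m0 by simp
  then show ?case
    unfolding warm_Suc[of x0 m0 0] warm_state.simps(1) bind_return_pmf
    using warm_stage[OF x0 x0 m0 _ 0] warm_m_growth(1)[OF \<gamma>, of m0 0] by (simp del: warm_m.simps(2))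
next
  case (Suc u)
  let ?m = "warm_m \<gamma> m0 (Suc u)" and ?m' = "warm_m \<gamma> m0 (Suc (Suc u))"
  let ?h = "\<lambda>uz. P (fst uz) - P xs + dist_weight \<gamma> M b ?m * (norm (xs - snd uz))\<^sup>2"
  have m: "1 \<le> ?m" "?m \<le> ?m'"
    using warm_m_mono[OF \<gamma>, of 0 "Suc u" m0] warm_m_mono[OF \<gamma>, of "Suc u" "Suc (Suc u)" m0] m0
    by auto
  note cl = warm_closed[OF x0, of m0 "Suc u"]
  have "measure_pmf.expectation (warm x0 m0 (Suc (Suc u)))
      (\<lambda>uz. P (fst uz) - P xs + dist_weight \<gamma> M b ?m' * (norm (xs - snd uz))\<^sup>2)
    \<le> measure_pmf.expectation (warm x0 m0 (Suc u)) (\<lambda>xz. 0 + 1 / \<gamma> * ?h xz)"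
    unfolding warm_Suc[of x0 m0 "Suc u"]
  proof (rule expectation_bind_le)
    show "finite (set_pmf (warm x0 m0 (Suc u)))" using cl by simp
    fix xz assume "xz \<in> set_pmf (warm x0 m0 (Suc u))"
    then have *: "fst xz \<in> Rd d" "snd xz \<in> Rd d" using cl by auto
    show "finite (set_pmf (one_stage_accsvrda d n f R (snd xz) (fst xz) (step_size n L \<gamma> M b) ?m' b Q))"
      by (rule stage_finite[OF *(2,1) b \<gamma>_pos])
    have "measure_pmf.expectation (one_stage_accsvrda d n f R (snd xz) (fst xz) (step_size n L \<gamma> M b) ?m' b Q)
        (\<lambda>uz. P (fst uz) - P xs + dist_weight \<gamma> M b ?m' * (norm (xs - snd uz))\<^sup>2)
      \<le> 1 / \<gamma> * (F (fst xz) - lin xs (fst xz) + dist_weight \<gamma> M b ?m * (norm (xs - snd xz))\<^sup>2)"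
      using m Suc.prems by (intro warm_stage * warm_m_growth(1)[OF \<gamma>]) (auto simp del: warm_m.simps)
    also have "\<dots> \<le> 1 / \<gamma> * ?h xz"
      using Bregman_at_minimizer[OF xs xs_min *(1)] \<gamma>_pos by (intro mult_left_mono add_right_mono) auto
    finally show "measure_pmf.expectation
        (one_stage_accsvrda d n f R (snd xz) (fst xz) (step_size n L \<gamma> M b) ?m' b Q)
        (\<lambda>uz. P (fst uz) - P xs + dist_weight \<gamma> M b ?m' * (norm (xs - snd uz))\<^sup>2)
      \<le> 0 + 1 / \<gamma> * ?h xz" by simp
  qed
  also have "\<dots> = 1 / \<gamma> * measure_pmf.expectation (warm x0 m0 (Suc u)) ?h"
    using cl by (subst expectation_affine) auto
  also have "\<dots> \<le> 1 / \<gamma> * ((1 / \<gamma>) ^ Suc u * (F x0 - lin xs x0 + dist_weight \<gamma> M b m0 * (norm (xs - x0))\<^sup>2))"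
    using Suc.prems m \<gamma>_pos by (intro mult_left_mono Suc.IH) (auto simp del: warm_m.simps)
  finally show ?case by (simp only: power_Suc mult.assoc)
qed

end

text \<open>
  The constant covers both kinds of first stage: \<open>9 * 5\<close> if there is no warm-start stage, and
  \<open>9 * 3\<close> after at least one, where the excess itself has already been reduced.
\<close>

lemma (in composite_problem) warm_start_rate:
  fixes m0 U :: nat
  assumes x0: "x0 \<in> Rd d" and xs: "xs \<in> Rd d" and xs_min: "\<And>x. x \<in> Rd d \<Longrightarrow> P xs \<le> P x"
    and \<gamma>: "\<gamma> \<ge> 3" and b: "b \<ge> 1" and m0: "m0 \<ge> 1" and S: "S \<ge> 1"
  defines "M \<equiv> warm_m_final \<gamma> m0 U"
  shows "measure_pmf.expectation (dasvrda_ns_warm d n f R x0 \<gamma> L m0 m b U S) (\<lambda>x. P x - P xs)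
    \<le> 45 / (real S)\<^sup>2 * ((1 / \<gamma>) ^ U *
        (F x0 - lin xs x0 + dist_weight \<gamma> M b m0 * (norm (x0 - xs))\<^sup>2))"
proof -
  let ?mU = "warm_m \<gamma> m0 U"
  have mU: "1 \<le> ?mU" using warm_m_mono[OF \<gamma>, of 0 U m0] m0 by simp
  have MU: "?mU \<le> M" "real ?mU * (real ?mU + 1) \<le> real M * (real M + 1)"
    using warm_m_final_bounds[OF \<gamma>, of m0 U] by (simp_all add: M_def)
  interpret das_loop d n f L R xs \<gamma> b M
    using xs xs_min \<gamma> b mU MU by unfold_locales auto
  have K: "K \<le> dist_weight \<gamma> M b ?mU"
    using dist_weight_antimono[OF mU zero_less_one, of M] MU(2) by (simp only: mult_1 div_by_1)
  let ?\<Psi> = "F x0 - lin xs x0 + dist_weight \<gamma> M b m0 * (norm (xs - x0))\<^sup>2"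
  have \<Psi>: "?\<Psi> \<ge> 0"
    using lin_le_F[OF x0 xs] dist_weight_nonneg[of \<gamma> M b m0] \<gamma> by simp
  have warm_eq: "dasvrda_ns_warm d n f R x0 \<gamma> L m0 m b U S =
      warm x0 m0 U \<bind> (\<lambda>xz. dasvrda_ns d n f R (fst xz) (snd xz) \<gamma> L M b S)"
    by (simp add: dasvrda_ns_warm_def M_def case_prod_unfold Let_def)
  show ?thesis
  proof (cases U)
    case 0
    have "measure_pmf.expectation (dasvrda_ns_warm d n f R x0 \<gamma> L m0 m b U S) (\<lambda>x. P x - P xs)
        \<le> 9 / (real S)\<^sup>2 * (5 * (F x0 - lin xs x0 + K * (norm (xs - x0))\<^sup>2))"
      unfolding warm_eq using loop_rate[OF x0 x0 S first_energy_equal_start[OF x0]]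
      by (simp add: 0 bind_return_pmf)
    also have "\<dots> \<le> 9 / (real S)\<^sup>2 * (5 * ?\<Psi>)"
      using K by (intro mult_left_mono add_left_mono mult_right_mono) (auto simp: 0)
    finally show ?thesis by (simp add: 0 norm_minus_commute)
  next
    case (Suc u)
    let ?h = "\<lambda>xz. P (fst xz) - P xs + dist_weight \<gamma> M b ?mU * (norm (xs - snd xz))\<^sup>2"
    note cl = warm_closed[OF x0, of m0 U]
    have "measure_pmf.expectation (dasvrda_ns_warm d n f R x0 \<gamma> L m0 m b U S) (\<lambda>x. P x - P xs)
        \<le> measure_pmf.expectation (warm x0 m0 U) (\<lambda>xz. 0 + 27 / (real S)\<^sup>2 * ?h xz)"
      unfolding warm_eq
    proof (rule expectation_bind_le)
      show "finite (set_pmf (warm x0 m0 U))" using cl by simp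
      fix xz assume "xz \<in> set_pmf (warm x0 m0 U)"
      then have *: "fst xz \<in> Rd d" "snd xz \<in> Rd d" using cl by auto
      show "finite (set_pmf (dasvrda_ns d n f R (fst xz) (snd xz) \<gamma> L M b S))"
        using loop_closed[OF *, of S] by (simp add: dasvrda_ns_def)
      have "measure_pmf.expectation (dasvrda_ns d n f R (fst xz) (snd xz) \<gamma> L M b S) (\<lambda>x. P x - P xs)
          \<le> 9 / (real S)\<^sup>2 * (3 * (P (fst xz) - P xs) + K * (norm (xs - snd xz))\<^sup>2)"
        by (rule loop_rate[OF * S first_energy[OF *]])
      also have "\<dots> \<le> 9 / (real S)\<^sup>2 * (3 * (P (fst xz) - P xs)
          + 3 * (dist_weight \<gamma> M b ?mU * (norm (xs - snd xz))\<^sup>2))"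
      proof -
        have "K * (norm (xs - snd xz))\<^sup>2 \<le> dist_weight \<gamma> M b ?mU * (norm (xs - snd xz))\<^sup>2"
          using K by (rule mult_right_mono) simp
        moreover have "0 \<le> K * (norm (xs - snd xz))\<^sup>2" using K_nonneg by simp
        ultimately show ?thesis by (intro mult_left_mono add_left_mono) auto
      qed
      finally show "measure_pmf.expectation (dasvrda_ns d n f R (fst xz) (snd xz) \<gamma> L M b S) (\<lambda>x. P x - P xs)
          \<le> 0 + 27 / (real S)\<^sup>2 * ?h xz" by (simp add: algebra_simps)
    qed
    also have "\<dots> = 27 / (real S)\<^sup>2 * measure_pmf.expectation (warm x0 m0 U) ?h"
      using cl by (subst expectation_affine) auto
    also have "\<dots> \<le> 27 / (real S)\<^sup>2 * ((1 / \<gamma>) ^ U * ?\<Psi>)"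
      using warm_decay[OF x0 m0, of u] MU unfolding Suc by (intro mult_left_mono) auto
    also have "\<dots> \<le> 45 / (real S)\<^sup>2 * ((1 / \<gamma>) ^ U * ?\<Psi>)"
      using \<Psi> \<gamma> by (intro mult_right_mono divide_right_mono) auto
    finally show ?thesis by (simp add: norm_minus_commute)
  qed
qed


section \<open>The choice of the parameters\<close>

text \<open>
  The value of \<open>\<gamma>\<close> is the positive root of a quadratic equation. For \<open>r = (m + 1) / b\<close> that equation
  reads \<open>\<gamma>\<^sup>2 r = 3 \<gamma> r + 2\<close>, which makes even \<open>\<gamma>\<^sup>2 r\<close> of order \<open>1 + r\<close>.
\<close>

lemma gamma_star:
  fixes m b :: nat
  assumes b: "b \<ge> 1" and \<gamma>: "\<gamma> = 1 / 2 * (3 + sqrt (9 + 8 * real b / (real m + 1)))"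
  defines "r \<equiv> (real m + 1) / real b"
  shows "\<gamma> \<ge> 3" "\<gamma> * r \<le> 1 + 5 * r" "\<gamma>\<^sup>2 * r \<le> 5 + 15 * r"
proof -
  define q where "q = sqrt (9 + 8 * real b / (real m + 1))"
  have r: "r > 0" using b by (simp add: r_def)
  have \<gamma>q: "\<gamma> = (3 + q) / 2" by (simp add: \<gamma> q_def)
  have q2: "q\<^sup>2 = 9 + 8 / r" by (simp add: q_def r_def)
  have q0: "q \<ge> 0" by (simp add: q_def)
  have "3\<^sup>2 \<le> q\<^sup>2" using r by (simp add: q2)
  then have "3 \<le> q" using q0 by (rule power2_le_imp_le)
  then show \<gamma>3: "\<gamma> \<ge> 3" by (simp add: \<gamma>q)
  have "\<gamma>\<^sup>2 * r = (9 + 6 * q + q\<^sup>2) / 4 * r"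
    by (simp add: \<gamma>q power2_eq_square field_simps)
  also have "\<dots> = 3 * (\<gamma> * r) + 2"
    unfolding q2 \<gamma>q using r by (simp add: field_simps)
  finally have quad: "\<gamma>\<^sup>2 * r = 3 * (\<gamma> * r) + 2" .
  show t: "\<gamma> * r \<le> 1 + 5 * r"
  proof (cases "\<gamma> * r \<le> 1")
    case False
    have "\<gamma>\<^sup>2 * r * r = (3 * (\<gamma> * r) + 2) * r" using quad by simp
    then have "(\<gamma> * r) * (\<gamma> * r) = (3 * (\<gamma> * r) + 2) * r" by (simp add: power2_eq_square mult_ac)
    also have "\<dots> \<le> (5 * (\<gamma> * r)) * r" using False r by (intro mult_right_mono) auto
    finally have "(\<gamma> * r) * (\<gamma> * r) \<le> (5 * r) * (\<gamma> * r)" by (simp add: mult_ac)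
    then have "\<gamma> * r \<le> 5 * r" using False by (simp add: mult_le_cancel_right)
    then show ?thesis by simp
  qed (use r in auto)
  show "\<gamma>\<^sup>2 * r \<le> 5 + 15 * r" using t by (simp add: quad)
qed

text \<open>
  The logarithm makes \<open>sqrt \<gamma> ^ U\<close> equal to \<open>m / m0\<close> up to one factor \<open>sqrt \<gamma>\<close> lost by rounding.
\<close>

lemma number_of_warm_stages:
  fixes m m0 U :: nat
  assumes \<gamma>: "\<gamma> \<ge> 3" and m: "1 \<le> m0" "m0 \<le> m" and U: "U = nat \<lceil>log (sqrt \<gamma>) (real m / real m0)\<rceil>"
  shows "real m / real m0 \<le> sqrt \<gamma> ^ U" "sqrt \<gamma> ^ U \<le> sqrt \<gamma> * (real m / real m0)"
    and "(1 / \<gamma>) ^ U \<le> (real m0 / real m)\<^sup>2"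
proof -
  let ?g = "sqrt \<gamma>" and ?\<rho> = "real m / real m0"
  have g: "?g > 1" using \<gamma> by simp
  have \<rho>: "?\<rho> \<ge> 1" using m by simp
  have "log ?g ?\<rho> \<ge> 0" using g \<rho> by simp
  note U' = nat_ceiling_bounds[OF this, folded U]
  have e: "?g powr log ?g ?\<rho> = ?\<rho>" using g \<rho> by simp
  have "?g powr log ?g ?\<rho> \<le> ?g powr real U" using g U' by (intro powr_mono) auto
  then show lo: "?\<rho> \<le> ?g ^ U" using g by (simp only: e powr_realpow)
  have "?g powr real U \<le> ?g powr (log ?g ?\<rho> + 1)" using g U' by (intro powr_mono) auto
  then show "?g ^ U \<le> ?g * ?\<rho>" using g by (simp add: e powr_realpow powr_add mult.commute)
  have "?\<rho>\<^sup>2 \<le> (?g ^ U)\<^sup>2" using lo \<rho> by (intro power_mono) auto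
  also have "\<dots> = \<gamma> ^ U" using \<gamma> by (simp add: power_mult[symmetric] mult.commute[of U] power_mult)
  finally have "1 / \<gamma> ^ U \<le> 1 / ?\<rho>\<^sup>2" using \<rho> m by (intro divide_left_mono mult_pos_pos) (use \<gamma> in auto)
  then show "(1 / \<gamma>) ^ U \<le> (real m0 / real m)\<^sup>2" by (simp add: power_one_over power_divide)
qed

text \<open>
  The factor \<open>\<gamma>\<close> in this bound can be large, when \<open>b\<close> is much larger than \<open>m\<close>. It is harmless, since the
  inverse step size then contains \<open>\<gamma>\<^sup>2 (m + 1) / b\<close>, which the choice of \<open>\<gamma>\<close> controls.
\<close>

lemma final_stage_length:
  fixes m m0 U :: nat
  assumes \<gamma>: "\<gamma> \<ge> 3" and m: "1 \<le> m0" "m0 \<le> m" and U: "U = nat \<lceil>log (sqrt \<gamma>) (real m / real m0)\<rceil>"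
  shows "real (warm_m_final \<gamma> m0 U) + 1 \<le> 6 * \<gamma> * real m"
proof -
  have "real (warm_m_final \<gamma> m0 U) + 1 \<le> 3 / 2 * (real (warm_m \<gamma> m0 U) + 3)"
    by (rule warm_m_final_bounds(3)[OF \<gamma>])
  also have "\<dots> \<le> 3 / 2 * (sqrt \<gamma> ^ U * (real m0 + 3))"
    using warm_m_le_power[OF \<gamma>, of m0 U] by simp
  also have "\<dots> \<le> 3 / 2 * ((sqrt \<gamma> * (real m / real m0)) * (4 * real m0))"
    using number_of_warm_stages(2)[OF assms] \<gamma> m by (intro mult_left_mono mult_mono) auto
  also have "\<dots> = 6 * sqrt \<gamma> * real m" using m by simp
  also have "\<dots> \<le> 6 * \<gamma> * real m"
  proof -
    have "sqrt \<gamma> \<le> \<gamma>" using \<gamma> by (intro real_le_lsqrt) (auto simp: power2_eq_square)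
    then show ?thesis by (intro mult_right_mono mult_left_mono) auto
  qed
  finally show ?thesis .
qed

text \<open>
  The initial length \<open>m0\<close> balances the excess against the distance term. When rounding lifts it to
  one, the excess \<open>E\<close> is no longer controlled by the distance, but its smooth part \<open>D\<close> still is.
\<close>

lemma initial_length_balance:
  fixes m m0 :: nat
  assumes lb: "l > 0" and N: "N > 0" and E: "E > 0" and c: "c \<ge> 1"
    and D: "0 \<le> D" "D \<le> E" "D \<le> l / 2 * N"
    and m: "m \<ge> 1" and m0: "m0 = min (nat \<lceil>sqrt (c * l * (N / E))\<rceil>) m"
  shows "1 \<le> m0" "m0 \<le> m" "(real m0)\<^sup>2 * D \<le> 4 * c * l * N"
proof -
  let ?v = "sqrt (c * l * (N / E))"
  have v: "?v > 0" using assms by simp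
  note ceil = nat_ceiling_bounds[OF less_imp_le[OF v]]
  have "real (nat \<lceil>?v\<rceil>) > 0" using v ceil(1) by linarith
  then have "1 \<le> nat \<lceil>?v\<rceil>" unfolding of_nat_0_less_iff by linarith
  then show "1 \<le> m0" "m0 \<le> m"
    using m unfolding m0 by (simp_all only: min.bounded_iff min.cobounded2 simp_thms)
  have m0_le: "real m0 \<le> real (nat \<lceil>?v\<rceil>)" by (simp add: m0)
  show "(real m0)\<^sup>2 * D \<le> 4 * c * l * N"
  proof (cases "?v \<le> 1")
    case True
    then have "\<lceil>?v\<rceil> \<le> 1" by (simp add: ceiling_le_iff)
    then have "real m0 \<le> 1" using m0_le by linarith
    then have "(real m0)\<^sup>2 \<le> 1\<^sup>2" by (intro power_mono) auto
    then have "(real m0)\<^sup>2 * D \<le> 1 * D" using D by (intro mult_right_mono) auto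
    also have "\<dots> \<le> 1 * (l * N)" using D lb N by simp
    also have "\<dots> \<le> (4 * c) * (l * N)" using c lb N by (intro mult_right_mono) auto
    finally show ?thesis by (simp add: mult.assoc)
  next
    case False
    then have "real m0 \<le> 2 * ?v" using ceil(2) m0_le by linarith
    then have "(real m0)\<^sup>2 \<le> (2 * ?v)\<^sup>2" by (intro power_mono) auto
    also have "\<dots> = 4 * (c * l * (N / E))" using assms by (simp add: power_mult_distrib)
    finally have "(real m0)\<^sup>2 * D \<le> 4 * (c * l * (N / E)) * E"
      using D assms by (intro mult_mono) auto
    then show ?thesis using E by simp
  qed
qed

text \<open>
  With \<open>\<rho> = m / b\<close>, both terms of the potential times \<open>m0\<^sup>2\<close> are of order \<open>1 + \<rho>\<close>: the Bregman distance
  by the choice of \<open>m0\<close>, the distance term because its weight is inversely proportional to \<open>m0\<^sup>2\<close>.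
\<close>

lemma (in composite_problem) initial_potential_bound:
  fixes m m0 b U :: nat
  assumes x0: "x0 \<in> Rd d" and xs: "xs \<in> Rd d" and xs_min: "\<And>x. x \<in> Rd d \<Longrightarrow> P xs \<le> P x"
    and excess: "P xs < P x0" and m: "m \<ge> 1" and b: "b \<ge> 1"
    and \<gamma>: "\<gamma> = 1 / 2 * (3 + sqrt (9 + 8 * real b / (real m + 1)))"
    and m0: "m0 = min (nat \<lceil>sqrt ((1 + \<gamma> * (real m + 1) / real b) * Lbar *
                   ((norm (x0 - xs))\<^sup>2 / (P x0 - P xs)))\<rceil>) m"
    and U: "U = nat \<lceil>log (sqrt \<gamma>) (real m / real m0)\<rceil>"
  shows "1 \<le> m0"
    and "(1 / \<gamma>) ^ U * (F x0 - lin xs x0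
        + dist_weight \<gamma> (warm_m_final \<gamma> m0 U) b m0 * (norm (x0 - xs))\<^sup>2)
      \<le> 400 * ((1 / (real m)\<^sup>2 + 1 / (real m * real b)) * Lbar * (norm (x0 - xs))\<^sup>2)"
proof -
  define N where "N = (norm (x0 - xs))\<^sup>2"
  define D where "D = F x0 - lin xs x0"
  define r where "r = (real m + 1) / real b"
  define \<rho> where "\<rho> = real m / real b"
  define M where "M = warm_m_final \<gamma> m0 U"
  note g = gamma_star[OF b \<gamma>, folded r_def]
  have N: "N > 0" using excess by (auto simp: N_def)
  have \<rho>: "\<rho> > 0" and r: "r \<le> 2 * \<rho>" "r > 0" "\<rho> \<le> r"
    using m b by (simp_all add: \<rho>_def r_def field_simps)
  have D: "0 \<le> D" "D \<le> P x0 - P xs" "D \<le> Lbar / 2 * N"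
    using lin_le_F[OF x0 xs] Bregman_at_minimizer[OF xs xs_min x0] F_le_lin[OF x0 xs]
    by (simp_all add: D_def N_def)
  have c: "1 + \<gamma> * (real m + 1) / real b = 1 + \<gamma> * r" by (simp add: r_def)
  have "1 \<le> 1 + \<gamma> * r" using g(1) r by simp
  note m0_facts = initial_length_balance[OF Lbar_pos N _ this D m m0[unfolded c, folded N_def]]
  have m0_1: "1 \<le> m0" and m0_m: "m0 \<le> m" and m0_D: "(real m0)\<^sup>2 * D \<le> 4 * (1 + \<gamma> * r) * Lbar * N"
    using m0_facts excess by auto
  show "1 \<le> m0" by fact
  have "(real m0)\<^sup>2 * D \<le> 4 * (1 + (1 + 5 * (2 * \<rho>))) * Lbar * N"
    using m0_D
  proof (rule order.trans)
    have "\<gamma> * r \<le> 1 + 5 * (2 * \<rho>)" using g(2) r by linarith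
    then show "4 * (1 + \<gamma> * r) * Lbar * N \<le> 4 * (1 + (1 + 5 * (2 * \<rho>))) * Lbar * N"
      using Lbar_pos N by (intro mult_right_mono) auto
  qed
  also have "\<dots> \<le> 40 * (1 + \<rho>) * Lbar * N"
    using Lbar_pos N by (intro mult_right_mono) auto
  finally have first: "(real m0)\<^sup>2 * D \<le> 40 * (1 + \<rho>) * Lbar * N" .
  have second: "(real m0)\<^sup>2 * (dist_weight \<gamma> M b m0 * N) \<le> 360 * (1 + \<rho>) * Lbar * N"
  proof -
    have "\<gamma> * (real M + 1) / real b \<le> \<gamma> * (6 * \<gamma> * real m) / real b"
      using final_stage_length[OF g(1) m0_1 m0_m U] g(1) unfolding M_def
      by (intro divide_right_mono mult_left_mono) auto
    also have "\<dots> = 6 * (\<gamma>\<^sup>2 * \<rho>)" by (simp add: \<rho>_def power2_eq_square)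
    also have "\<dots> \<le> 6 * (\<gamma>\<^sup>2 * r)" using r by (intro mult_left_mono) auto
    also have "\<dots> \<le> 6 * (5 + 15 * (2 * \<rho>))" using g(3) r by simp
    finally have step: "1 + \<gamma> * (real M + 1) / real b \<le> 180 * (1 + \<rho>)" by simp
    have "(real m0)\<^sup>2 * dist_weight \<gamma> M b m0
        = 2 * (1 + \<gamma> * (real M + 1) / real b) * Lbar * (real m0 / (real m0 + 1))"
      using m0_1 by (simp add: dist_weight_def step_size_def power2_eq_square)
    also have "\<dots> \<le> 2 * (1 + \<gamma> * (real M + 1) / real b) * Lbar * 1"
      using Lbar_pos g(1) by (intro mult_left_mono) auto
    also have "\<dots> \<le> 2 * (180 * (1 + \<rho>)) * Lbar * 1"
      using step Lbar_pos by (intro mult_right_mono mult_left_mono) auto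
    finally have "(real m0)\<^sup>2 * dist_weight \<gamma> M b m0 * N \<le> 2 * (180 * (1 + \<rho>)) * Lbar * 1 * N"
      using N by (intro mult_right_mono) auto
    then show ?thesis by (simp add: mult.assoc)
  qed
  have "(1 / \<gamma>) ^ U * (D + dist_weight \<gamma> M b m0 * N)
      \<le> (real m0 / real m)\<^sup>2 * (D + dist_weight \<gamma> M b m0 * N)"
    using number_of_warm_stages(3)[OF g(1) m0_1 m0_m U] D N dist_weight_nonneg[of \<gamma> M b m0] g(1)
    by (intro mult_right_mono) auto
  also have "\<dots> = ((real m0)\<^sup>2 * D + (real m0)\<^sup>2 * (dist_weight \<gamma> M b m0 * N)) / (real m)\<^sup>2"
    by (simp add: power_divide distrib_left add_divide_distrib)
  also have "\<dots> \<le> (40 * (1 + \<rho>) * Lbar * N + 360 * (1 + \<rho>) * Lbar * N) / (real m)\<^sup>2"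
    using first second by (intro divide_right_mono add_mono) auto
  also have "\<dots> = 400 * (((1 + \<rho>) / (real m)\<^sup>2) * Lbar * N)" by (simp add: algebra_simps)
  also have "(1 + \<rho>) / (real m)\<^sup>2 = 1 / (real m)\<^sup>2 + 1 / (real m * real b)"
    using m b by (simp add: \<rho>_def field_simps power2_eq_square)
  finally show "(1 / \<gamma>) ^ U * (F x0 - lin xs x0
        + dist_weight \<gamma> (warm_m_final \<gamma> m0 U) b m0 * (norm (x0 - xs))\<^sup>2)
      \<le> 400 * ((1 / (real m)\<^sup>2 + 1 / (real m * real b)) * Lbar * (norm (x0 - xs))\<^sup>2)"
    by (simp only: D_def N_def M_def)
qed


section \<open>The convergence rate\<close>

theorem theorem5p2:
  "\<exists>C::real. C > 0 \<and>
    (\<forall>(d::nat) (n::nat) (f :: nat \<Rightarrow> rvec \<Rightarrow> real) (L :: nat \<Rightarrow> real) (R :: rvec \<Rightarrow> real)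
       (P :: rvec \<Rightarrow> real) (xs::rvec) (x0::rvec) (m::nat) (b::nat) (S::nat)
       (\<gamma>::real) (m0::nat) (U::nat).
       d \<ge> 1 \<longrightarrow> n \<ge> 1 \<longrightarrow>
       (\<forall>i\<in>{1..n}. L i > 0 \<and> convex_on (Rd d) (f i) \<and> smooth d (L i) (f i)) \<longrightarrow>
       convex_on (Rd d) R \<longrightarrow>
       P = (\<lambda>x. avg_fun n f x + R x) \<longrightarrow>
       xs \<in> Rd d \<longrightarrow> (\<forall>x\<in>Rd d. P xs \<le> P x) \<longrightarrow>
       x0 \<in> Rd d \<longrightarrow> P x0 > P xs \<longrightarrow>
       m \<ge> 1 \<longrightarrow> b \<in> {1..n} \<longrightarrow> S \<ge> 1 \<longrightarrow>
       \<gamma> = 1 / 2 * (3 + sqrt (9 + 8 * real b / (real m + 1))) \<longrightarrow>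
       m0 = min (nat \<lceil>sqrt ((1 + \<gamma> * (real m + 1) / real b) * avg n L *
                   ((norm (x0 - xs))\<^sup>2 / (P x0 - P xs)))\<rceil>) m \<longrightarrow>
       U = nat \<lceil>log (sqrt \<gamma>) (real m / real m0)\<rceil> \<longrightarrow>
       measure_pmf.expectation (dasvrda_ns_warm d n f R x0 \<gamma> L m0 m b U S) (\<lambda>x. P x - P xs)
         \<le> C * (1 / (real S)\<^sup>2 * (1 / (real m)\<^sup>2 + 1 / (real m * real b)) * avg n L
                  * (norm (x0 - xs))\<^sup>2))"
proof (intro exI[of _ "18000::real"] conjI allI impI)
  fix d n :: nat and f :: "nat \<Rightarrow> rvec \<Rightarrow> real" and L :: "nat \<Rightarrow> real" and R P :: "rvec \<Rightarrow> real"
    and xs x0 :: rvec and m b S :: nat and \<gamma> :: real and m0 U :: nat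
  assume n: "n \<ge> 1" and f: "\<forall>i\<in>{1..n}. L i > 0 \<and> convex_on (Rd d) (f i) \<and> smooth d (L i) (f i)"
    and R: "convex_on (Rd d) R" and P: "P = (\<lambda>x. avg_fun n f x + R x)"
    and xs: "xs \<in> Rd d" and min: "\<forall>x\<in>Rd d. P xs \<le> P x"
    and x0: "x0 \<in> Rd d" and excess: "P x0 > P xs"
    and m: "m \<ge> 1" and b: "b \<in> {1..n}" and S: "S \<ge> 1"
    and \<gamma>: "\<gamma> = 1 / 2 * (3 + sqrt (9 + 8 * real b / (real m + 1)))"
    and m0: "m0 = min (nat \<lceil>sqrt ((1 + \<gamma> * (real m + 1) / real b) * avg n L *
                   ((norm (x0 - xs))\<^sup>2 / (P x0 - P xs)))\<rceil>) m"
    and U: "U = nat \<lceil>log (sqrt \<gamma>) (real m / real m0)\<rceil>"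
  interpret composite_problem d n f L R
    using n f R by unfold_locales auto
  have P_eq: "P = composite_problem.P n f R"
    by (simp add: P fun_eq_iff P_def)
  have b1: "b \<ge> 1" using b by simp
  have min': "\<And>x. x \<in> Rd d \<Longrightarrow> P xs \<le> P x" using min by blast
  note init = initial_potential_bound[OF x0 xs min'[unfolded P_eq] excess[unfolded P_eq] m b1 \<gamma>
      m0[unfolded P_eq] U]
  let ?B = "(1 / (real m)\<^sup>2 + 1 / (real m * real b)) * avg n L * (norm (x0 - xs))\<^sup>2"
  have "measure_pmf.expectation (dasvrda_ns_warm d n f R x0 \<gamma> L m0 m b U S) (\<lambda>x. P x - P xs)
      \<le> 45 / (real S)\<^sup>2 * ((1 / \<gamma>) ^ U *
        (avg_fun n f x0 - lin xs x0 + dist_weight \<gamma> (warm_m_final \<gamma> m0 U) b m0 * (norm (x0 - xs))\<^sup>2))"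
    unfolding P_eq
    by (rule warm_start_rate[OF x0 xs min'[unfolded P_eq] gamma_star(1)[OF b1 \<gamma>] b1 init(1) S])
  also have "\<dots> \<le> 45 / (real S)\<^sup>2 * (400 * ?B)"
    by (intro mult_left_mono init(2)) auto
  also have "\<dots> = 18000 * (1 / (real S)\<^sup>2 * (1 / (real m)\<^sup>2 + 1 / (real m * real b)) * avg n L
                  * (norm (x0 - xs))\<^sup>2)" by (simp add: mult.assoc)
  finally show "measure_pmf.expectation (dasvrda_ns_warm d n f R x0 \<gamma> L m0 m b U S) (\<lambda>x. P x - P xs)
         \<le> 18000 * (1 / (real S)\<^sup>2 * (1 / (real m)\<^sup>2 + 1 / (real m * real b)) * avg n L
                  * (norm (x0 - xs))\<^sup>2)" .
qed simp

end
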